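(* Let $c\ge 1$ and let $\mathcal N_c$ be the variety of nilpotent groups of class at most $c$. Let $G$ be a semidirect product of $A$ by $B$ under $\theta:B\to\mathrm{Aut}(A)$, let $1\to R_1\to F_1\xrightarrow{\nu_1}A\to 1$ be a free presentation of $A$, let $K=F_1*B$, and let $T$ be the normal subgroup of $K$ defined in the context. Then there exists an epimorphism $$\mathcal N_cM(G)\longrightarrow \mathcal N_cM(B)\oplus\frac{T\cap\gamma_{c+1}(K)}{[T,\,_cK]}.$$ Consequently, if $G$ is finite, then $\mathcal N_cM(G)$ has a subgroup isomorphic to $$\mathcal N_cM(B)\oplus\frac{T\cap\gamma_{c+1}(K)}{[T,\,_cK]}.$$
   Context: Conventions: $[x,y]=x^{-1}y^{-1}xy$; for subgroups, $[X,\,_cY]=[X,Y,\dots,Y]$ with $c$ copies of $Y$, left-normed; $\gamma_{c+1}(X)$ is the $(c+1)$-st term of the lower central series; for a subset $X$ of a group $Y$, $\langle X\rangle^Y$ is the normal closure of $X$ in $Y$. For a group $G\cong F/R$ with $F$ free, the Baer invariant of $G$ with respect to $\mathcal N_c$ (the $c$-nilpotent multiplier) is $\mathcal N_cM(G)=(R\cap\gamma_{c+1}(F))/[R,\,_cF]$, an abelian group independent, up to isomorphism, of the free presentation. Semidirect product of $A$ by $B$ under $\theta$: $A$ is normal, $B$ is a complement, and $b^{-1}ab=\theta(b)(a)$ for $a\in A$, $b\in B$ (automorphisms are composed from left to right, i.e. $\theta(bb')(a)=\theta(b')(\theta(b)(a))$). With $1\to R_1\to F_1\xrightarrow{\nu_1}A\to1$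 a free presentation of $A$ and $K=F_1*B$ the free product, $$T=\langle f_1^{-1}\bar f_1[b,f_1]\ :\ f_1,\bar f_1\in F_1,\ b\in B,\ \nu_1(\bar f_1)=\theta(b)(\nu_1(f_1))\rangle^K .$$ *)

theory Defs
  imports "HOL-Algebra.Generated_Groups" "HOL-Algebra.Bij"
begin

section \<open>Groups given by words and defining relations\<close>

text \<open>Words over the alphabet \<open>S\<close> modulo the congruence generated by the pairs of words in
  \<open>R\<close>; free groups and free products are special cases.\<close>

inductive word_step :: "'s set \<Rightarrow> ('s list \<times> 's list) set \<Rightarrow> 's list \<Rightarrow> 's list \<Rightarrow> bool"
  for S R where
  "\<lbrakk>u \<in> lists S; v \<in> lists S; (l, r) \<in> R; l \<in> lists S; r \<in> lists S\<rbrakk>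
    \<Longrightarrow> word_step S R (u @ l @ v) (u @ r @ v)"

definition word_cong :: "'s set \<Rightarrow> ('s list \<times> 's list) set \<Rightarrow> ('s list \<times> 's list) set" where
  "word_cong S R = {(u, v). u \<in> lists S \<and> v \<in> lists S \<and> equivclp (word_step S R) u v}"

definition word_group :: "'s set \<Rightarrow> ('s list \<times> 's list) set \<Rightarrow> 's list set monoid" where
  "word_group S R =
    \<lparr>carrier = lists S // word_cong S R,
     monoid.mult = (\<lambda>P Q. \<Union>p\<in>P. \<Union>q\<in>Q. word_cong S R `` {p @ q}),
     one = word_cong S R `` {[]}\<rparr>"

text \<open>The letter \<open>(x, True)\<close> stands for \<open>x\<close> and \<open>(x, False)\<close> for its inverse.\<close>

definition free_group :: "'x set \<Rightarrow> ('x \<times> bool) list set monoid" where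
  "free_group X = word_group (X \<times> UNIV) {([(x, e), (x, \<not> e)], []) | x e. x \<in> X}"

definition free_product_rels ::
    "'a monoid \<Rightarrow> 'b monoid \<Rightarrow> (('a + 'b) list \<times> ('a + 'b) list) set" where
  "free_product_rels G H =
     {([Inl x, Inl y], [Inl (x \<otimes>\<^bsub>G\<^esub> y)]) | x y. x \<in> carrier G \<and> y \<in> carrier G}
   \<union> {([Inr x, Inr y], [Inr (x \<otimes>\<^bsub>H\<^esub> y)]) | x y. x \<in> carrier H \<and> y \<in> carrier H}
   \<union> {([Inl \<one>\<^bsub>G\<^esub>], []), ([Inr \<one>\<^bsub>H\<^esub>], [])}"

definition free_product :: "'a monoid \<Rightarrow> 'b monoid \<Rightarrow> ('a + 'b) list set monoid" where
  "free_product G H = word_group (carrier G <+> carrier H) (free_product_rels G H)"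

definition fp_inl :: "'a monoid \<Rightarrow> 'b monoid \<Rightarrow> 'a \<Rightarrow> ('a + 'b) list set" where
  "fp_inl G H x = word_cong (carrier G <+> carrier H) (free_product_rels G H) `` {[Inl x]}"

definition fp_inr :: "'a monoid \<Rightarrow> 'b monoid \<Rightarrow> 'b \<Rightarrow> ('a + 'b) list set" where
  "fp_inr G H y = word_cong (carrier G <+> carrier H) (free_product_rels G H) `` {[Inr y]}"


section \<open>Free presentations\<close>

text \<open>Taking \<open>X\<close> in the element type of \<open>F\<close> is no restriction on the rank: a basis of \<open>F\<close> is a
  subset of \<open>carrier F\<close>.\<close>

definition is_free_group :: "'f monoid \<Rightarrow> bool" where
  "is_free_group F \<longleftrightarrow> group F \<and> (\<exists>X :: 'f set. F \<cong> free_group X)"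

text \<open>The kernel \<open>R\<close> of the presentation \<open>1 \<rightarrow> R \<rightarrow> F \<rightarrow> G \<rightarrow> 1\<close> is \<open>kernel F G \<nu>\<close>.\<close>

definition free_presentation :: "'f monoid \<Rightarrow> ('f \<Rightarrow> 'a) \<Rightarrow> 'a monoid \<Rightarrow> bool" where
  "free_presentation F \<nu> G \<longleftrightarrow> is_free_group F \<and> group G \<and> \<nu> \<in> epi F G"


section \<open>Commutators, the lower central series and normal closures\<close>

text \<open>Convention \<open>[x, y] = x\<inverse> y\<inverse> x y\<close>, which differs from the one behind the library's
  \<open>derived\<close>.\<close>

definition commutator :: "('a, 'm) monoid_scheme \<Rightarrow> 'a \<Rightarrow> 'a \<Rightarrow> 'a" where
  "commutator G x y = inv\<^bsub>G\<^esub> x \<otimes>\<^bsub>G\<^esub> inv\<^bsub>G\<^esub> y \<otimes>\<^bsub>G\<^esub> x \<otimes>\<^bsub>G\<^esub> y"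

definition commutator_subgroup :: "('a, 'm) monoid_scheme \<Rightarrow> 'a set \<Rightarrow> 'a set \<Rightarrow> 'a set" where
  "commutator_subgroup G X Y = generate G {commutator G x y | x y. x \<in> X \<and> y \<in> Y}"

text \<open>\<open>iter_commutator G X Y c\<close> is the left-normed \<open>[X, Y, \<dots>, Y]\<close> with \<open>c\<close> copies of \<open>Y\<close>.\<close>

primrec iter_commutator :: "('a, 'm) monoid_scheme \<Rightarrow> 'a set \<Rightarrow> 'a set \<Rightarrow> nat \<Rightarrow> 'a set" where
  "iter_commutator G X Y 0 = X"
| "iter_commutator G X Y (Suc c) = commutator_subgroup G (iter_commutator G X Y c) Y"

text \<open>\<open>lower_central G n\<close> is \<open>\<gamma>\<^sub>n(G)\<close>, indexed so that \<open>\<gamma>\<^sub>1(G) = G\<close>; the value at \<open>0\<close> is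
  irrelevant.\<close>

primrec lower_central :: "('a, 'm) monoid_scheme \<Rightarrow> nat \<Rightarrow> 'a set" where
  "lower_central G 0 = carrier G"
| "lower_central G (Suc n) =
    (if n = 0 then carrier G else commutator_subgroup G (lower_central G n) (carrier G))"

definition normal_closure :: "('a, 'm) monoid_scheme \<Rightarrow> 'a set \<Rightarrow> 'a set" where
  "normal_closure G X = \<Inter>{N. N \<lhd> G \<and> X \<subseteq> N}"


section \<open>The Baer invariant\<close>

text \<open>\<open>(N \<inter> \<gamma>\<^bsub>c+1\<^esub>(Y)) / [N, \<^sub>c Y]\<close> for a normal subgroup \<open>N\<close> of \<open>Y\<close>.\<close>

definition Baer_quotient :: "nat \<Rightarrow> 'a monoid \<Rightarrow> 'a set \<Rightarrow> 'a set monoid" where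
  "Baer_quotient c Y N =
    (Y\<lparr>carrier := N \<inter> lower_central Y (c + 1)\<rparr>) Mod (iter_commutator Y N (carrier Y) c)"

text \<open>The \<open>c\<close>-nilpotent multiplier of \<open>G\<close>, computed from the free presentation \<open>\<nu> : F \<rightarrow> G\<close>.\<close>

definition nilpotent_multiplier ::
    "nat \<Rightarrow> 'f monoid \<Rightarrow> ('f \<Rightarrow> 'a) \<Rightarrow> 'a monoid \<Rightarrow> 'f set monoid" where
  "nilpotent_multiplier c F \<nu> G = Baer_quotient c F (kernel F G \<nu>)"


section \<open>Semidirect products\<close>

text \<open>Internal semidirect product. Automorphisms are composed from left to right, so \<open>\<theta>\<close> is a
  homomorphism into the opposite of \<open>AutoGroup\<close>.\<close>

definition semidirect_product ::
    "'a monoid \<Rightarrow> 'a set \<Rightarrow> 'a set \<Rightarrow> ('a \<Rightarrow> 'a \<Rightarrow> 'a) \<Rightarrow> bool" where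
  "semidirect_product G A B \<theta> \<longleftrightarrow>
     group G \<and> A \<lhd> G \<and> subgroup B G \<and> A <#>\<^bsub>G\<^esub> B = carrier G \<and> A \<inter> B = {\<one>\<^bsub>G\<^esub>} \<and>
     (\<forall>b\<in>B. \<theta> b \<in> auto (G\<lparr>carrier := A\<rparr>)) \<and>
     (\<forall>b\<in>B. \<forall>b'\<in>B. \<forall>a\<in>A. \<theta> (b \<otimes>\<^bsub>G\<^esub> b') a = \<theta> b' (\<theta> b a)) \<and>
     (\<forall>b\<in>B. \<forall>a\<in>A. inv\<^bsub>G\<^esub> b \<otimes>\<^bsub>G\<^esub> a \<otimes>\<^bsub>G\<^esub> b = \<theta> b a)"

definition T_subgroup ::
    "'f monoid \<Rightarrow> ('f \<Rightarrow> 'a) \<Rightarrow> 'a monoid \<Rightarrow> ('a \<Rightarrow> 'a \<Rightarrow> 'a) \<Rightarrow> ('f + 'a) list set set" where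
  "T_subgroup F \<nu> B \<theta> =
    (let K = free_product F B; i = fp_inl F B; j = fp_inr F B in
     normal_closure K
       {inv\<^bsub>K\<^esub> (i f) \<otimes>\<^bsub>K\<^esub> i f' \<otimes>\<^bsub>K\<^esub> commutator K (j b) (i f) | f f' b.
          f \<in> carrier F \<and> f' \<in> carrier F \<and> b \<in> carrier B \<and> \<nu> f' = \<theta> b (\<nu> f)})"


section \<open>Universal properties\<close>

lemma word_step_append:
  assumes "word_step S R u v" "w \<in> lists S"
  shows "word_step S R (w @ u) (w @ v)" "word_step S R (u @ w) (v @ w)"
  using assms
proof (atomize (full), induction rule: word_step.induct)
  case (1 u v l r)
  then show ?case
    using word_step.intros[of "w @ u" S v l r R] word_step.intros[of u S "v @ w" l r R]
    by auto
qed

lemma word_cong_append_left: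
  assumes "(u, v) \<in> word_cong S R" "w \<in> lists S"
  shows "(w @ u, w @ v) \<in> word_cong S R"
proof -
  have "equivclp (word_step S R) u v \<Longrightarrow> equivclp (word_step S R) (w @ u) (w @ v)"
  proof (induction rule: equivclp_induct)
    case (step y z)
    then have "word_step S R (w @ y) (w @ z) \<or> word_step S R (w @ z) (w @ y)"
      using word_step_append assms(2) by blast
    then show ?case
      by (elim disjE) (auto intro: equivclp_trans[OF step.IH] r_into_equivclp converse_r_into_equivclp)
  qed simp
  with assms show ?thesis by (auto simp: word_cong_def)
qed

lemma word_cong_append_right:
  assumes "(u, v) \<in> word_cong S R" "w \<in> lists S"
  shows "(u @ w, v @ w) \<in> word_cong S R"
proof -
  have "equivclp (word_step S R) u v \<Longrightarrow> equivclp (word_step S R) (u @ w) (v @ w)"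
  proof (induction rule: equivclp_induct)
    case (step y z)
    then have "word_step S R (y @ w) (z @ w) \<or> word_step S R (z @ w) (y @ w)"
      using word_step_append assms(2) by blast
    then show ?case
      by (elim disjE) (auto intro: equivclp_trans[OF step.IH] r_into_equivclp converse_r_into_equivclp)
  qed simp
  with assms show ?thesis by (auto simp: word_cong_def)
qed

lemma equiv_word_cong: "equiv (lists S) (word_cong S R)"
proof (rule equivI)
  show "sym (word_cong S R)" by (rule symI) (simp add: word_cong_def equivclp_sym)
  show "trans (word_cong S R)"
    by (rule transI) (auto simp: word_cong_def simp del: in_lists_conv_set intro: equivclp_trans)
qed (auto simp: word_cong_def refl_on_def)

lemma word_cong_append:
  assumes "(u, u') \<in> word_cong S R" "(v, v') \<in> word_cong S R"
  shows "(u @ v, u' @ v') \<in> word_cong S R"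
proof -
  have vu: "v \<in> lists S" "u' \<in> lists S" using assms unfolding word_cong_def by blast+
  have "trans (word_cong S R)" using equiv_word_cong by (rule equivE)
  then show ?thesis
    by (rule transD[OF _ word_cong_append_right[OF assms(1) vu(1)]
      word_cong_append_left[OF assms(2) vu(2)]])
qed

lemma word_group_mult:
  assumes "u \<in> lists S" "v \<in> lists S"
  shows "word_cong S R `` {u} \<otimes>\<^bsub>word_group S R\<^esub> word_cong S R `` {v} = word_cong S R `` {u @ v}"
proof -
  have "word_cong S R `` {p @ q} = word_cong S R `` {u @ v}"
    if "p \<in> word_cong S R `` {u}" "q \<in> word_cong S R `` {v}" for p q
  proof -
    have "(u @ v, p @ q) \<in> word_cong S R" using that by (intro word_cong_append) blast+
    then show ?thesis using equiv_class_eq[OF equiv_word_cong] by blast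
  qed
  moreover have "u \<in> word_cong S R `` {u}" "v \<in> word_cong S R `` {v}"
    by (rule equiv_class_self[OF equiv_word_cong assms(1)],
        rule equiv_class_self[OF equiv_word_cong assms(2)])
  ultimately have "(\<Union>p\<in>word_cong S R `` {u}. \<Union>q\<in>word_cong S R `` {v}. word_cong S R `` {p @ q})
      = word_cong S R `` {u @ v}"
    by blast
  then show ?thesis by (simp add: word_group_def)
qed

lemma word_group_carrier:
  "carrier (word_group S R) = (\<lambda>u. word_cong S R `` {u}) ` lists S"
  by (auto simp: word_group_def quotient_def)

lemma monoid_word_group: "monoid (word_group S R)"
proof (rule monoidI)
  have *: "carrier (word_group S R) = (\<lambda>u. word_cong S R `` {u}) ` lists S"
    "\<one>\<^bsub>word_group S R\<^esub> = word_cong S R `` {[]}"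
    by (rule word_group_carrier) (simp add: word_group_def)
  show "\<one>\<^bsub>word_group S R\<^esub> \<in> carrier (word_group S R)" unfolding * by blast
  fix x y z assume "x \<in> carrier (word_group S R)"
  then obtain u where u: "u \<in> lists S" "x = word_cong S R `` {u}" unfolding * by blast
  show "\<one>\<^bsub>word_group S R\<^esub> \<otimes>\<^bsub>word_group S R\<^esub> x = x" "x \<otimes>\<^bsub>word_group S R\<^esub> \<one>\<^bsub>word_group S R\<^esub> = x"
    using u by (simp_all add: * word_group_mult)
  assume "y \<in> carrier (word_group S R)"
  then obtain v where v: "v \<in> lists S" "y = word_cong S R `` {v}" unfolding * by blast
  show "x \<otimes>\<^bsub>word_group S R\<^esub> y \<in> carrier (word_group S R)"
    using u v by (auto simp: * word_group_mult)
  assume "z \<in> carrier (word_group S R)"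
  then obtain w where w: "w \<in> lists S" "z = word_cong S R `` {w}" unfolding * by blast
  show "x \<otimes>\<^bsub>word_group S R\<^esub> y \<otimes>\<^bsub>word_group S R\<^esub> z = x \<otimes>\<^bsub>word_group S R\<^esub> (y \<otimes>\<^bsub>word_group S R\<^esub> z)"
    using u v w by (simp add: * word_group_mult)
qed

lemma word_group_rel:
  assumes "(l, r) \<in> R" "l \<in> lists S" "r \<in> lists S"
  shows "word_cong S R `` {l} = word_cong S R `` {r}"
proof -
  have "word_step S R l r" using word_step.intros[of "[]" S "[]" l r R] assms by simp
  then have "(l, r) \<in> word_cong S R" using assms by (auto simp: word_cong_def)
  then show ?thesis by (rule equiv_class_eq[OF equiv_word_cong])
qed

lemma group_word_group:
  assumes "\<And>s. s \<in> S \<Longrightarrow> \<exists>t\<in>S. word_cong S R `` {[t, s]} = word_cong S R `` {[]}"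
  shows "group (word_group S R)"
proof -
  interpret monoid "word_group S R" by (rule monoid_word_group)
  have one: "\<one>\<^bsub>word_group S R\<^esub> = word_cong S R `` {[]}" by (simp add: word_group_def)
  have "\<exists>v\<in>lists S. word_cong S R `` {v @ u} = word_cong S R `` {[]}" if "u \<in> lists S" for u
    using that
  proof induction
    case (Cons s u)
    obtain v where v: "v \<in> lists S" "word_cong S R `` {v @ u} = word_cong S R `` {[]}"
      by (rule bexE[OF Cons.IH])
    obtain t where t: "t \<in> S" "word_cong S R `` {[t, s]} = word_cong S R `` {[]}"
      by (rule bexE[OF assms[OF Cons.hyps(1)]])
    have "([t, s], []) \<in> word_cong S R"
      using t Cons.hyps by (intro eq_equiv_class[OF t(2) equiv_word_cong]) simp
    then have "(v @ [t, s] @ u, v @ [] @ u) \<in> word_cong S R"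
      by (rule word_cong_append_left[OF word_cong_append_right[OF _ Cons.hyps(2)] v(1)])
    then have "word_cong S R `` {v @ [t, s] @ u} = word_cong S R `` {[]}"
      using v(2) equiv_class_eq[OF equiv_word_cong, of "v @ [t, s] @ u" "v @ u" S R] by simp
    then show ?case using v(1) t(1) by (intro bexI[of _ "v @ [t]"]) simp_all
  qed (rule bexI[of _ "[]"], simp_all)
  note inverse_word = this
  have "\<exists>y\<in>carrier (word_group S R). y \<otimes>\<^bsub>word_group S R\<^esub> x = \<one>\<^bsub>word_group S R\<^esub>"
    if x: "x \<in> carrier (word_group S R)" for x
  proof -
    obtain u where u: "u \<in> lists S" "x = word_cong S R `` {u}"
      using x unfolding word_group_carrier by blast
    obtain v where v: "v \<in> lists S" "word_cong S R `` {v @ u} = word_cong S R `` {[]}"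
      using inverse_word[OF u(1)] by (rule bexE)
    have "word_cong S R `` {v} \<in> carrier (word_group S R)"
      using v(1) by (simp add: word_group_def quotientI)
    moreover have "word_cong S R `` {v} \<otimes>\<^bsub>word_group S R\<^esub> x = \<one>\<^bsub>word_group S R\<^esub>"
      unfolding one u(2) word_group_mult[OF v(1) u(1)] by (rule v(2))
    ultimately show ?thesis by blast
  qed
  then show ?thesis by (intro groupI) (simp_all add: m_assoc)
qed

text \<open>Every assignment of the letters in a group that respects the relations extends.\<close>

lemma word_group_hom_exists:
  fixes H :: "('a, 'm) monoid_scheme"
  assumes H: "group H" and f: "f \<in> S \<rightarrow> carrier H"
    and rel: "\<And>l r. (l, r) \<in> R \<Longrightarrow> l \<in> lists S \<Longrightarrow> r \<in> lists S \<Longrightarrow>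
      foldr (\<lambda>s x. f s \<otimes>\<^bsub>H\<^esub> x) l \<one>\<^bsub>H\<^esub> = foldr (\<lambda>s x. f s \<otimes>\<^bsub>H\<^esub> x) r \<one>\<^bsub>H\<^esub>"
  shows "\<exists>\<phi>\<in>hom (word_group S R) H. \<forall>s\<in>S. \<phi> (word_cong S R `` {[s]}) = f s"
proof -
  interpret H: group H by fact
  define ev where "ev u = foldr (\<lambda>s x. f s \<otimes>\<^bsub>H\<^esub> x) u \<one>\<^bsub>H\<^esub>" for u
  have ev_closed: "ev u \<in> carrier H" if "u \<in> lists S" for u
    using that f by induction (auto simp: ev_def)
  have ev_app: "ev (u @ v) = ev u \<otimes>\<^bsub>H\<^esub> ev v" if "u \<in> lists S" "v \<in> lists S" for u v
    using that
  proof induction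
    case Nil
    then show ?case using ev_closed by (simp add: ev_def)
  next
    case (Cons a l)
    then have "ev (l @ v) = ev l \<otimes>\<^bsub>H\<^esub> ev v" "f a \<in> carrier H" using f by auto
    then show ?case using ev_closed Cons by (simp add: ev_def H.m_assoc)
  qed
  have step: "ev u = ev v" if "word_step S R u v" for u v
    using that
  proof induction
    case (1 u v l r)
    then have "ev l = ev r" using rel by (simp add: ev_def)
    with 1 show ?case by (simp add: ev_app)
  qed
  have cong: "ev u = ev v" if "(u, v) \<in> word_cong S R" for u v
  proof -
    have "equivclp (word_step S R) u v" using that by (simp add: word_cong_def)
    then show ?thesis by induction (auto dest: step)
  qed
  define \<phi> where "\<phi> P = ev (SOME u. u \<in> P)" for P
  have \<phi>: "\<phi> (word_cong S R `` {u}) = ev u" if "u \<in> lists S" for u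
  proof -
    have "u \<in> word_cong S R `` {u}" using that by (auto simp: word_cong_def)
    then have "(SOME w. w \<in> word_cong S R `` {u}) \<in> word_cong S R `` {u}" by (rule someI)
    then show ?thesis unfolding \<phi>_def using cong by (metis Image_singleton_iff)
  qed
  have "\<phi> \<in> hom (word_group S R) H"
  proof (rule homI)
    fix x y assume "x \<in> carrier (word_group S R)"
    then obtain u where u: "u \<in> lists S" "x = word_cong S R `` {u}"
      unfolding word_group_carrier by blast
    show "\<phi> x \<in> carrier H" using u ev_closed \<phi> by metis
    assume "y \<in> carrier (word_group S R)"
    then obtain v where v: "v \<in> lists S" "y = word_cong S R `` {v}"
      unfolding word_group_carrier by blast
    have uv: "u @ v \<in> lists S" using u v by simp
    show "\<phi> (x \<otimes>\<^bsub>word_group S R\<^esub> y) = \<phi> x \<otimes>\<^bsub>H\<^esub> \<phi> y"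
      unfolding u(2) v(2) word_group_mult[OF u(1) v(1)] \<phi>[OF u(1)] \<phi>[OF v(1)] \<phi>[OF uv]
      by (rule ev_app[OF u(1) v(1)])
  qed
  moreover have "\<phi> (word_cong S R `` {[s]}) = f s" if "s \<in> S" for s
    using \<phi>[of "[s]"] that funcset_mem[OF f that] by (simp add: ev_def)
  ultimately show ?thesis by blast
qed

lemma group_free_group: "group (free_group X)"
  unfolding free_group_def
proof (rule group_word_group)
  let ?R = "{([(x, e), (x, \<not> e)], []) | x e. x \<in> X}"
  fix s assume "s \<in> X \<times> (UNIV :: bool set)"
  then obtain x e where s: "s = (x, e)" "x \<in> X" by auto
  have "([(x, \<not> e), s], []) \<in> ?R"
    using s by (intro CollectI exI[of _ x] exI[of _ "\<not> e"]) simp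
  then have "word_cong (X \<times> UNIV) ?R `` {[(x, \<not> e), s]} = word_cong (X \<times> UNIV) ?R `` {[]}"
    using s by (intro word_group_rel) auto
  with s show "\<exists>t\<in>X \<times> UNIV. word_cong (X \<times> UNIV) ?R `` {[t, s]} = word_cong (X \<times> UNIV) ?R `` {[]}"
    by (intro bexI[of _ "(x, \<not> e)"]) simp_all
qed

lemma free_group_hom_exists:
  fixes H :: "('a, 'm) monoid_scheme"
  assumes "group H" "f \<in> X \<rightarrow> carrier H"
  shows "\<exists>\<phi>\<in>hom (free_group X) H. \<forall>x\<in>X.
    \<phi> (word_cong (X \<times> UNIV) {([(x, e), (x, \<not> e)], []) | x e. x \<in> X} `` {[(x, True)]}) = f x"
proof -
  interpret H: group H by fact
  let ?g = "\<lambda>(x, e). if e then f x else inv\<^bsub>H\<^esub> f x"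
  let ?R = "{([(x, e), (x, \<not> e)], []) | x e. x \<in> X}"
  have "\<exists>\<phi>\<in>hom (word_group (X \<times> UNIV) ?R) H. \<forall>s\<in>X \<times> UNIV. \<phi> (word_cong (X \<times> UNIV) ?R `` {[s]}) = ?g s"
    using assms by (intro word_group_hom_exists) (auto simp: Pi_iff)
  then obtain \<phi> where \<phi>: "\<phi> \<in> hom (word_group (X \<times> UNIV) ?R) H"
      "\<And>s. s \<in> X \<times> UNIV \<Longrightarrow> \<phi> (word_cong (X \<times> UNIV) ?R `` {[s]}) = ?g s"
    by blast
  then show ?thesis unfolding free_group_def by (intro bexI[of _ \<phi>]) auto
qed

lemma group_free_product:
  assumes "group G" "group H"
  shows "group (free_product G H)"
  unfolding free_product_def
proof (rule group_word_group)
  interpret G: group G by fact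
  interpret H: group H by fact
  let ?S = "carrier G <+> carrier H" and ?R = "free_product_rels G H"
  fix s assume "s \<in> ?S"
  then show "\<exists>t\<in>?S. word_cong ?S ?R `` {[t, s]} = word_cong ?S ?R `` {[]}"
  proof
    fix x assume x: "s = Inl x" "x \<in> carrier G"
    have "([Inl (inv\<^bsub>G\<^esub> x), Inl x], [Inl (inv\<^bsub>G\<^esub> x \<otimes>\<^bsub>G\<^esub> x)]) \<in> ?R"
      unfolding free_product_rels_def using x G.inv_closed by blast
    then have "([Inl (inv\<^bsub>G\<^esub> x), Inl x], [Inl \<one>\<^bsub>G\<^esub>]) \<in> ?R" using x by simp
    moreover have "([Inl \<one>\<^bsub>G\<^esub>], []) \<in> ?R" by (simp add: free_product_rels_def)
    ultimately have "word_cong ?S ?R `` {[Inl (inv\<^bsub>G\<^esub> x), s]} = word_cong ?S ?R `` {[]}"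
      using x word_group_rel[of "[Inl (inv\<^bsub>G\<^esub> x), Inl x]" "[Inl \<one>\<^bsub>G\<^esub>]" ?R ?S]
        word_group_rel[of "[Inl \<one>\<^bsub>G\<^esub>]" "[]" ?R ?S]
      by auto
    then show ?thesis using x by (intro bexI[of _ "Inl (inv\<^bsub>G\<^esub> x)"]) auto
  next
    fix x assume x: "s = Inr x" "x \<in> carrier H"
    have "([Inr (inv\<^bsub>H\<^esub> x), Inr x], [Inr (inv\<^bsub>H\<^esub> x \<otimes>\<^bsub>H\<^esub> x)]) \<in> ?R"
      unfolding free_product_rels_def using x H.inv_closed by blast
    then have "([Inr (inv\<^bsub>H\<^esub> x), Inr x], [Inr \<one>\<^bsub>H\<^esub>]) \<in> ?R" using x by simp
    moreover have "([Inr \<one>\<^bsub>H\<^esub>], []) \<in> ?R" by (simp add: free_product_rels_def)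
    ultimately have "word_cong ?S ?R `` {[Inr (inv\<^bsub>H\<^esub> x), s]} = word_cong ?S ?R `` {[]}"
      using x word_group_rel[of "[Inr (inv\<^bsub>H\<^esub> x), Inr x]" "[Inr \<one>\<^bsub>H\<^esub>]" ?R ?S]
        word_group_rel[of "[Inr \<one>\<^bsub>H\<^esub>]" "[]" ?R ?S]
      by auto
    then show ?thesis using x by (intro bexI[of _ "Inr (inv\<^bsub>H\<^esub> x)"]) auto
  qed
qed

lemma free_product_inj_hom:
  assumes "group G" "group H"
  shows "fp_inl G H \<in> hom G (free_product G H)" "fp_inr G H \<in> hom H (free_product G H)"
proof -
  interpret G: group G by fact
  interpret H: group H by fact
  let ?S = "carrier G <+> carrier H" and ?R = "free_product_rels G H"
  show "fp_inl G H \<in> hom G (free_product G H)"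
  proof (rule homI)
    fix x assume x: "x \<in> carrier G"
    then show "fp_inl G H x \<in> carrier (free_product G H)"
      unfolding fp_inl_def free_product_def word_group_carrier by (intro imageI) auto
    fix y assume y: "y \<in> carrier G"
    have "word_cong ?S ?R `` {[Inl x, Inl y]} = word_cong ?S ?R `` {[Inl (x \<otimes>\<^bsub>G\<^esub> y)]}"
      using x y by (intro word_group_rel) (auto simp: free_product_rels_def)
    then show "fp_inl G H (x \<otimes>\<^bsub>G\<^esub> y) = fp_inl G H x \<otimes>\<^bsub>free_product G H\<^esub> fp_inl G H y"
      unfolding fp_inl_def free_product_def
      using word_group_mult[of "[Inl x]" ?S "[Inl y]" ?R] x y by auto
  qed
  show "fp_inr G H \<in> hom H (free_product G H)"
  proof (rule homI)
    fix x assume x: "x \<in> carrier H"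
    then show "fp_inr G H x \<in> carrier (free_product G H)"
      unfolding fp_inr_def free_product_def word_group_carrier by (intro imageI) auto
    fix y assume y: "y \<in> carrier H"
    have "word_cong ?S ?R `` {[Inr x, Inr y]} = word_cong ?S ?R `` {[Inr (x \<otimes>\<^bsub>H\<^esub> y)]}"
      using x y by (intro word_group_rel) (auto simp: free_product_rels_def)
    then show "fp_inr G H (x \<otimes>\<^bsub>H\<^esub> y) = fp_inr G H x \<otimes>\<^bsub>free_product G H\<^esub> fp_inr G H y"
      unfolding fp_inr_def free_product_def
      using word_group_mult[of "[Inr x]" ?S "[Inr y]" ?R] x y by auto
  qed
qed

lemma free_product_hom_exists:
  fixes L :: "('c, 'm) monoid_scheme"
  assumes "group G" "group H" "group L" "g \<in> hom G L" "h \<in> hom H L"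
  shows "\<exists>\<phi>\<in>hom (free_product G H) L.
    (\<forall>x\<in>carrier G. \<phi> (fp_inl G H x) = g x) \<and> (\<forall>y\<in>carrier H. \<phi> (fp_inr G H y) = h y)"
proof -
  interpret L: group L by fact
  let ?S = "carrier G <+> carrier H" and ?R = "free_product_rels G H"
  have "g \<one>\<^bsub>G\<^esub> = \<one>\<^bsub>L\<^esub>" "h \<one>\<^bsub>H\<^esub> = \<one>\<^bsub>L\<^esub>" using assms by (auto intro: hom_one)
  then have "\<exists>\<phi>\<in>hom (word_group ?S ?R) L. \<forall>s\<in>?S. \<phi> (word_cong ?S ?R `` {[s]}) = case_sum g h s"
    using assms
    by (intro word_group_hom_exists) (auto simp: hom_def Pi_iff free_product_rels_def L.m_assoc)
  then obtain \<phi> where \<phi>: "\<phi> \<in> hom (word_group ?S ?R) L"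
      "\<And>s. s \<in> ?S \<Longrightarrow> \<phi> (word_cong ?S ?R `` {[s]}) = case_sum g h s"
    by blast
  then show ?thesis
    unfolding free_product_def fp_inl_def fp_inr_def using \<phi>(2)[OF InlI] \<phi>(2)[OF InrI]
    by (intro bexI[of _ \<phi>]) auto
qed

end

theory Submission
  imports Defs "HOL-Algebra.Multiplicative_Group" "HOL-Algebra.Elementary_Groups"
    "HOL-Computational_Algebra.Primes"
begin

text \<open>
  The group \<open>K = F\<^sub>1 * B\<close> maps onto \<open>G\<close>, by \<open>\<nu>\<^sub>1\<close> on \<open>F\<^sub>1\<close> and by inclusion on \<open>B\<close>, and \<open>T\<close> is exactly the
  kernel of this map (\<open>T_subgroup_eq_kernel\<close>): the generators of \<open>T\<close> say that \<open>b \<in> B\<close> conjugates \<open>F\<^sub>1\<close>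
  as \<open>\<theta>(b)\<close> prescribes, which turns the free product into an extension of \<open>B\<close> by an image of \<open>F\<^sub>1\<close>.  So
  \<open>(T \<inter> \<gamma>\<^bsub>c+1\<^esub>(K)) / [T, \<^sub>c K]\<close> is a Baer quotient of a presentation of \<open>G\<close> that need not be free, just
  as \<open>\<N>\<^sub>cM(B)\<close> is one of the free presentation \<open>F\<^sub>B\<close> of \<open>B\<close>.

  Since \<open>F\<^sub>G\<close> is free, the maps \<open>F\<^sub>G \<rightarrow> G\<close> and \<open>F\<^sub>G \<rightarrow> G \<rightarrow> B\<close> lift to \<open>\<alpha> : F\<^sub>G \<rightarrow> K\<close> and
  \<open>\<beta> : F\<^sub>G \<rightarrow> F\<^sub>B\<close>, and \<open>(\<beta>, \<alpha>)\<close> induces the desired homomorphism.  These lifts need not be onto.  But two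
  homomorphisms into \<open>K\<close> that agree modulo \<open>T\<close> agree on \<open>\<gamma>\<^bsub>c+1\<^esub>\<close> modulo \<open>[T, \<^sub>c K]\<close>
  (\<open>hom_agree_lower_central\<close>), so on the level of Baer quotients nothing depends on the lifts.  This
  reduces surjectivity to the group \<open>F\<^sub>1 * F\<^sub>B\<close>, which maps to \<open>F\<^sub>G\<close> over \<open>G\<close>, maps onto \<open>K\<close>, and retracts
  onto \<open>F\<^sub>B\<close>.  There an element over a given element of \<open>T \<inter> \<gamma>\<^bsub>c+1\<^esub>(K)\<close> can be multiplied by an
  element of \<open>F\<^sub>B\<close> in the kernel of \<open>\<nu>\<^sub>B\<close>, which dies in \<open>K\<close>, so as to prescribe its retraction as well
  (\<open>Baer_quotient_joint_epi\<close>).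

  If \<open>G\<close> is finite, Baer's extension of Schur's theorem makes \<open>\<gamma>\<^bsub>c+1\<^esub>(F\<^sub>G) / [R, \<^sub>c F\<^sub>G]\<close> finite, where
  \<open>R\<close> is the kernel of \<open>\<nu>\<^sub>G\<close> (\<open>finite_index_lower_central\<close>).  Hence \<open>\<N>\<^sub>cM(G)\<close> is a finite abelian group,
  and every subgroup of such a group is the kernel of an endomorphism (\<open>endomorphism_with_kernel\<close>), so that
  each of its epimorphic images is isomorphic to a subgroup.
\<close>

section \<open>Commutator calculus\<close>

lemma (in group) inv_mult_cancel_left [simp]:
  assumes "x \<in> carrier G" "y \<in> carrier G"
  shows "inv x \<otimes> (x \<otimes> y) = y" "x \<otimes> (inv x \<otimes> y) = y"
  using assms by (simp_all flip: m_assoc)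

lemma (in group) commutator_closed [simp, intro]:
  assumes "x \<in> carrier G" "y \<in> carrier G"
  shows "commutator G x y \<in> carrier G"
  using assms by (simp add: commutator_def)

lemma (in group) commutator_eq_one_iff:
  assumes "x \<in> carrier G" "y \<in> carrier G"
  shows "commutator G x y = \<one> \<longleftrightarrow> x \<otimes> y = y \<otimes> x"
proof -
  have "commutator G x y = inv (y \<otimes> x) \<otimes> (x \<otimes> y)"
    using assms by (simp add: commutator_def inv_mult_group m_assoc)
  then show ?thesis using assms by (metis inv_closed inv_inv inv_equality l_inv m_closed)
qed

lemma (in group) conj_commutator:
  assumes "g \<in> carrier G" "x \<in> carrier G" "y \<in> carrier G"
  shows "g \<otimes> commutator G x y \<otimes> inv g = commutator G (g \<otimes> x \<otimes> inv g) (g \<otimes> y \<otimes> inv g)"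
  using assms by (simp add: commutator_def inv_mult_group m_assoc)

lemma (in group_hom) hom_commutator:
  assumes "x \<in> carrier G" "y \<in> carrier G"
  shows "h (commutator G x y) = commutator H (h x) (h y)"
  using assms by (simp add: commutator_def)

text \<open>Statements about elements modulo a normal subgroup \<open>N\<close> are proved by computing in a group
  \<open>Q\<close> where \<open>N\<close> has become trivial.\<close>

lemma normal_is_kernel:
  fixes G :: "('a, 'm) monoid_scheme" (structure)
  assumes "N \<lhd> G"
  obtains Q :: "'a set monoid" and h
  where "group_hom G Q h" "h ` carrier G = carrier Q" "N = kernel G Q h"
proof -
  interpret normal N G by fact
  have gh: "group_hom G (G Mod N) (\<lambda>x. N #> x)"
    using r_coset_hom_Mod factorgroup_is_group
    by (simp add: group_hom_def group_hom_axioms_def is_group)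
  have "N = kernel G (G Mod N) (\<lambda>x. N #> x)"
    using is_subgroup by (auto simp: kernel_def coset_join2 dest: coset_join1)
  then show ?thesis
    by (intro that[of "G Mod N" "\<lambda>x. N #> x"] gh) (auto simp: carrier_FactGroup)
qed

lemma (in group_hom) kernel_iff:
  "x \<in> carrier G \<Longrightarrow> x \<in> kernel G H h \<longleftrightarrow> h x = \<one>\<^bsub>H\<^esub>"
  by (simp add: kernel_def)

lemma (in group_hom) kernel_diff_iff:
  assumes "x \<in> carrier G" "y \<in> carrier G"
  shows "x \<otimes> inv y \<in> kernel G H h \<longleftrightarrow> h x = h y"
  using assms by (metis G.inv_closed G.m_closed H.inv_solve_right' H.one_closed H.l_one hom_closed
      hom_inv hom_mult kernel_iff)

lemma (in group_hom) commutator_kernel_iff: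
  assumes "x \<in> carrier G" "y \<in> carrier G"
  shows "commutator G x y \<in> kernel G H h \<longleftrightarrow> h x \<otimes>\<^bsub>H\<^esub> h y = h y \<otimes>\<^bsub>H\<^esub> h x"
  using assms by (simp add: kernel_iff hom_commutator H.commutator_eq_one_iff)

lemma (in group) commutator_subgroup_least:
  assumes "subgroup L G" "\<And>x y. x \<in> X \<Longrightarrow> y \<in> Y \<Longrightarrow> commutator G x y \<in> L"
  shows "commutator_subgroup G X Y \<subseteq> L"
  unfolding commutator_subgroup_def using assms by (intro generate_subgroup_incl) auto

lemma commutator_mem:
  "x \<in> X \<Longrightarrow> y \<in> Y \<Longrightarrow> commutator G x y \<in> commutator_subgroup G X Y"
  unfolding commutator_subgroup_def by (rule generate.incl) blast

lemma (in group) commutator_subgroup_normal: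
  assumes "X \<lhd> G" "Y \<lhd> G"
  shows "commutator_subgroup G X Y \<lhd> G"
  unfolding commutator_subgroup_def
proof (rule normal_generateI)
  interpret X: normal X G by fact
  interpret Y: normal Y G by fact
  show "{commutator G x y | x y. x \<in> X \<and> y \<in> Y} \<subseteq> carrier G" by auto
  fix h g assume "h \<in> {commutator G x y | x y. x \<in> X \<and> y \<in> Y}" "g \<in> carrier G"
  then show "g \<otimes> h \<otimes> inv g \<in> {commutator G x y | x y. x \<in> X \<and> y \<in> Y}"
    using X.inv_op_closed2 Y.inv_op_closed2 by (clarsimp simp: conj_commutator) blast
qed

lemma (in group) carrier_normal: "carrier G \<lhd> G"
  by (simp add: normal_inv_iff subgroup_self)

lemma (in group) commutator_mem_normal:
  assumes "X \<lhd> G" "x \<in> X" "y \<in> carrier G"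
  shows "commutator G x y \<in> X" "commutator G y x \<in> X"
proof -
  interpret normal X G by fact
  have x: "x \<in> carrier G" by (simp add: assms)
  have "inv x \<otimes> (inv y \<otimes> x \<otimes> y) \<in> X" using assms inv_op_closed1 by simp
  then show "commutator G x y \<in> X" using assms x by (simp add: commutator_def m_assoc)
  have "(inv y \<otimes> inv x \<otimes> y) \<otimes> x \<in> X" using assms inv_op_closed1 by simp
  then show "commutator G y x \<in> X" using assms x by (simp add: commutator_def m_assoc)
qed

lemma (in group) commutator_subgroup_le:
  assumes "X \<lhd> G" shows "commutator_subgroup G X (carrier G) \<subseteq> X"
  using assms by (intro commutator_subgroup_least normal_imp_subgroup commutator_mem_normal)

lemma (in group_hom) image_commutator_subgroup:
  assumes "X \<subseteq> carrier G" "Y \<subseteq> carrier G"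
  shows "h ` commutator_subgroup G X Y = commutator_subgroup H (h ` X) (h ` Y)"
proof -
  have "{commutator H x y | x y. x \<in> h ` X \<and> y \<in> h ` Y}
      = h ` {commutator G x y | x y. x \<in> X \<and> y \<in> Y}" (is "?L = h ` ?R")
  proof
    show "h ` ?R \<subseteq> ?L" using assms by (force simp: hom_commutator subset_iff)
    show "?L \<subseteq> h ` ?R"
    proof clarify
      fix x y assume xy: "x \<in> X" "y \<in> Y"
      then have "commutator H (h x) (h y) = h (commutator G x y)"
        using assms by (subst hom_commutator) auto
      with xy show "commutator H (h x) (h y) \<in> h ` ?R" by blast
    qed
  qed
  then show ?thesis unfolding commutator_subgroup_def using assms by (subst generate_img[symmetric]) auto
qed

lemma (in group) iter_commutator_normal:
  assumes "N \<lhd> G" shows "iter_commutator G N (carrier G) c \<lhd> G"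
  by (induction c) (auto simp: assms intro: commutator_subgroup_normal carrier_normal)

lemma (in group) iter_commutator_carrier:
  assumes "N \<lhd> G" "x \<in> iter_commutator G N (carrier G) c" shows "x \<in> carrier G"
  using iter_commutator_normal[OF assms(1)] assms(2) normal_imp_subgroup subgroup.mem_carrier by metis

lemma (in group) iter_commutator_Suc_le:
  assumes "N \<lhd> G"
  shows "iter_commutator G N (carrier G) (Suc c) \<subseteq> iter_commutator G N (carrier G) c"
  using assms by (simp add: commutator_subgroup_le iter_commutator_normal)

lemma (in group) iter_commutator_le:
  assumes "N \<lhd> G" shows "iter_commutator G N (carrier G) c \<subseteq> N"
  by (induction c) (use assms iter_commutator_Suc_le in auto)

lemma (in group_hom) image_iter_commutator:
  assumes "N \<lhd> G" "h ` carrier G = carrier H"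
  shows "h ` iter_commutator G N (carrier G) c = iter_commutator H (h ` N) (carrier H) c"
proof (induction c)
  case (Suc c)
  have "iter_commutator G N (carrier G) c \<subseteq> carrier G"
    using G.iter_commutator_carrier[OF assms(1)] by blast
  then show ?case using Suc assms(2) by (simp add: image_commutator_subgroup)
qed simp

lemma iter_commutator_mono:
  assumes "X \<subseteq> X'" "Y \<subseteq> Y'" "group G"
  shows "iter_commutator G X Y c \<subseteq> iter_commutator G X' Y' c"
proof (induction c)
  case (Suc c)
  then show ?case unfolding iter_commutator.simps commutator_subgroup_def
    by (intro group.mono_generate[OF assms(3)]) (use assms in blast)
qed (simp add: assms)

text \<open>A homomorphism need not be onto to preserve membership in the terms \<open>[N, \<^sub>c G]\<close>.\<close>

lemma (in group_hom) hom_iter_commutator: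
  assumes "N \<lhd> G" "h ` N \<subseteq> M" "x \<in> iter_commutator G N (carrier G) c"
  shows "h x \<in> iter_commutator H M (carrier H) c"
proof -
  have "h ` iter_commutator G N (carrier G) c = iter_commutator H (h ` N) (h ` carrier G) c"
  proof (induction c)
    case (Suc c)
    have "iter_commutator G N (carrier G) c \<subseteq> carrier G"
      using G.iter_commutator_carrier[OF assms(1)] by blast
    then show ?case using Suc by (simp add: image_commutator_subgroup)
  qed simp
  also have "\<dots> \<subseteq> iter_commutator H M (carrier H) c"
    by (rule iter_commutator_mono) (use assms in auto)
  finally show ?thesis using assms(3) by blast
qed

lemma lower_central_eq: "lower_central G (Suc c) = iter_commutator G (carrier G) (carrier G) c"
  by (induction c) auto

lemma (in group) lower_central_normal: "lower_central G (Suc c) \<lhd> G"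
  unfolding lower_central_eq by (intro iter_commutator_normal carrier_normal)

lemma (in group) lower_central_carrier: "x \<in> lower_central G (Suc c) \<Longrightarrow> x \<in> carrier G"
  unfolding lower_central_eq using iter_commutator_carrier carrier_normal by blast

lemma (in group_hom) hom_lower_central:
  "x \<in> lower_central G (Suc c) \<Longrightarrow> h x \<in> lower_central H (Suc c)"
  unfolding lower_central_eq by (rule hom_iter_commutator) (auto intro: G.carrier_normal)

lemma (in group) iter_commutator_le_lower_central:
  assumes "N \<lhd> G" shows "iter_commutator G N (carrier G) c \<subseteq> lower_central G (Suc c)"
  unfolding lower_central_eq
  by (rule iter_commutator_mono)
    (use normal_imp_subgroup[OF assms] subgroup.subset in \<open>auto intro: is_group\<close>)

lemma (in group) commute_inv:
  assumes "a \<in> carrier G" "t \<in> carrier G" "a \<otimes> t = t \<otimes> a"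
  shows "inv a \<otimes> t = t \<otimes> inv a"
  using assms by (metis inv_closed inv_solve_left inv_solve_right m_assoc m_closed)

text \<open>The elements that commute with a fixed element modulo \<open>L\<close> form a subgroup.\<close>

lemma (in group) commutator_generate_mem:
  assumes "L \<lhd> G" "t \<in> carrier G" "A \<subseteq> carrier G"
    and "\<And>a. a \<in> A \<Longrightarrow> commutator G t a \<in> L" and "x \<in> generate G A"
  shows "commutator G t x \<in> L"
proof -
  obtain Q :: "'a set monoid" and h where gh: "group_hom G Q h" and "h ` carrier G = carrier Q"
    and L: "L = kernel G Q h"
    by (rule normal_is_kernel[OF assms(1)])
  interpret h: group_hom G Q h by (rule gh)
  have iff: "commutator G t a \<in> L \<longleftrightarrow> h a \<otimes>\<^bsub>Q\<^esub> h t = h t \<otimes>\<^bsub>Q\<^esub> h a" if "a \<in> carrier G" for a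
    using that assms(2) by (auto simp: L h.commutator_kernel_iff)
  have "x \<in> carrier G \<and> h x \<otimes>\<^bsub>Q\<^esub> h t = h t \<otimes>\<^bsub>Q\<^esub> h x" using assms(5)
  proof induction
    case (incl a) then show ?case using assms iff by blast
  next
    case (inv a)
    then have a: "a \<in> carrier G" using assms by blast
    then have "h a \<otimes>\<^bsub>Q\<^esub> h t = h t \<otimes>\<^bsub>Q\<^esub> h a" using assms iff inv by blast
    then show ?case using a assms(2) by (simp add: h.H.commute_inv)
  next
    case (eng a b)
    then have "h a \<otimes>\<^bsub>Q\<^esub> (h b \<otimes>\<^bsub>Q\<^esub> h t) = h t \<otimes>\<^bsub>Q\<^esub> (h a \<otimes>\<^bsub>Q\<^esub> h b)"
      using assms(2) by (metis h.H.m_assoc h.hom_closed)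
    then show ?case using eng assms(2) by (simp add: h.H.m_assoc)
  qed (use assms in simp)
  then show ?thesis using iff by blast
qed

text \<open>This is the inclusion \<open>[N, \<gamma>\<^sub>i(G)] \<subseteq> [N, \<^sub>i G]\<close> for \<open>i \<ge> 1\<close>, a case of the three subgroups lemma.
  In the step to \<open>i + 1\<close>, compute modulo \<open>[N, \<^bsub>i+1\<^esub> G]\<close>.  Conjugation by \<open>x \<in> \<gamma>\<^sub>i(G)\<close> multiplies \<open>t \<in> N\<close>
  by an element \<open>u\<close> of \<open>[N, \<^sub>i G]\<close>, which is central.  Conjugation by \<open>y \<in> G\<close> multiplies \<open>t\<close> by an
  element \<open>v\<close> of \<open>[N, G]\<close>, which commutes with \<open>x\<close> by the induction hypothesis for \<open>[N, G]\<close>.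
  Hence the two conjugations commute on \<open>t\<close>, so \<open>t\<close> commutes with commutators of \<open>x\<close> and \<open>y\<close>.\<close>

lemma (in group) commutator_lower_central:
  assumes "N \<lhd> G" "t \<in> N" "x \<in> lower_central G (Suc i)"
  shows "commutator G t x \<in> iter_commutator G N (carrier G) (Suc i)"
  using assms
proof (induction i arbitrary: N t x)
  case 0
  then show ?case by (simp add: commutator_mem)
next
  case (Suc i)
  interpret N: normal N G by (rule Suc.prems(1))
  let ?L = "iter_commutator G N (carrier G) (Suc (Suc i))"
  have t: "t \<in> carrier G" using Suc.prems by simp
  have L: "?L \<lhd> G" using Suc.prems(1) by (rule iter_commutator_normal)
  have "commutator G t (commutator G (inv x) (inv y)) \<in> ?L"
    if x: "x \<in> lower_central G (Suc i)" and y: "y \<in> carrier G" for x y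
  proof -
    have xc: "x \<in> carrier G" using x by (rule lower_central_carrier)
    obtain Q :: "'a set monoid" and h where gh: "group_hom G Q h"
      and "h ` carrier G = carrier Q" and ker: "?L = kernel G Q h"
      by (rule normal_is_kernel[OF L])
    interpret h: group_hom G Q h by (rule gh)
    have comm: "h a \<otimes>\<^bsub>Q\<^esub> h b = h b \<otimes>\<^bsub>Q\<^esub> h a"
      if "commutator G a b \<in> ?L" "a \<in> carrier G" "b \<in> carrier G" for a b
      using that h.commutator_kernel_iff unfolding ker by blast
    define u where "u = commutator G t x"
    define v where "v = commutator G t y"
    have uv: "u \<in> carrier G" "v \<in> carrier G" using t xc y by (auto simp: u_def v_def)
    have u: "commutator G u g \<in> ?L" if "g \<in> carrier G" for g
      using Suc.IH[OF Suc.prems(1,2) x] that unfolding u_def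
      by (subst iter_commutator.simps) (intro commutator_mem)
    have "v \<in> commutator_subgroup G N (carrier G)"
      using Suc.prems(2) y unfolding v_def by (intro commutator_mem)
    moreover have "iter_commutator G (commutator_subgroup G N (carrier G)) (carrier G) k
        = iter_commutator G N (carrier G) (Suc k)" for k
      by (induction k) auto
    ultimately have v: "commutator G v x \<in> ?L"
      using Suc.IH[of "commutator_subgroup G N (carrier G)" v x] x Suc.prems(1)
        commutator_subgroup_normal carrier_normal by metis
    have tx: "h t \<otimes>\<^bsub>Q\<^esub> h x = h x \<otimes>\<^bsub>Q\<^esub> (h t \<otimes>\<^bsub>Q\<^esub> h u)"
      and ty: "h t \<otimes>\<^bsub>Q\<^esub> h y = h y \<otimes>\<^bsub>Q\<^esub> (h t \<otimes>\<^bsub>Q\<^esub> h v)"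
      using t xc y by (simp_all add: u_def v_def commutator_def h.H.m_assoc)
    note cc = t xc y uv
    have txy: "h t \<otimes>\<^bsub>Q\<^esub> (h x \<otimes>\<^bsub>Q\<^esub> h y) = (h x \<otimes>\<^bsub>Q\<^esub> h y) \<otimes>\<^bsub>Q\<^esub> (h t \<otimes>\<^bsub>Q\<^esub> h v \<otimes>\<^bsub>Q\<^esub> h u)"
    proof -
      have "h t \<otimes>\<^bsub>Q\<^esub> (h x \<otimes>\<^bsub>Q\<^esub> h y) = h x \<otimes>\<^bsub>Q\<^esub> (h t \<otimes>\<^bsub>Q\<^esub> (h u \<otimes>\<^bsub>Q\<^esub> h y))"
        using tx cc by (metis h.H.m_assoc h.H.m_closed h.hom_closed)
      also have "\<dots> = h x \<otimes>\<^bsub>Q\<^esub> ((h t \<otimes>\<^bsub>Q\<^esub> h y) \<otimes>\<^bsub>Q\<^esub> h u)"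
        using comm[OF u[OF y]] cc by (simp add: h.H.m_assoc)
      finally show ?thesis using ty cc by (simp add: h.H.m_assoc)
    qed
    have tyx: "h t \<otimes>\<^bsub>Q\<^esub> (h y \<otimes>\<^bsub>Q\<^esub> h x) = (h y \<otimes>\<^bsub>Q\<^esub> h x) \<otimes>\<^bsub>Q\<^esub> (h t \<otimes>\<^bsub>Q\<^esub> h v \<otimes>\<^bsub>Q\<^esub> h u)"
    proof -
      have "h t \<otimes>\<^bsub>Q\<^esub> (h y \<otimes>\<^bsub>Q\<^esub> h x) = h y \<otimes>\<^bsub>Q\<^esub> (h t \<otimes>\<^bsub>Q\<^esub> (h v \<otimes>\<^bsub>Q\<^esub> h x))"
        using ty cc by (metis h.H.m_assoc h.H.m_closed h.hom_closed)
      also have "\<dots> = h y \<otimes>\<^bsub>Q\<^esub> ((h t \<otimes>\<^bsub>Q\<^esub> h x) \<otimes>\<^bsub>Q\<^esub> h v)"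
        using comm[OF v] cc by (simp add: h.H.m_assoc)
      also have "\<dots> = h y \<otimes>\<^bsub>Q\<^esub> h x \<otimes>\<^bsub>Q\<^esub> (h t \<otimes>\<^bsub>Q\<^esub> (h u \<otimes>\<^bsub>Q\<^esub> h v))"
        using tx cc by (simp add: h.H.m_assoc)
      finally show ?thesis using comm[OF u[of v]] cc by (simp add: h.H.m_assoc)
    qed
    define w p q where "w = h t \<otimes>\<^bsub>Q\<^esub> h v \<otimes>\<^bsub>Q\<^esub> h u" and "p = h x \<otimes>\<^bsub>Q\<^esub> h y" and "q = h y \<otimes>\<^bsub>Q\<^esub> h x"
    have wpq: "w \<in> carrier Q" "p \<in> carrier Q" "q \<in> carrier Q" using cc by (simp_all add: w_def p_def q_def)
    have tp: "h t \<otimes>\<^bsub>Q\<^esub> p = p \<otimes>\<^bsub>Q\<^esub> w" and tq: "h t \<otimes>\<^bsub>Q\<^esub> q = q \<otimes>\<^bsub>Q\<^esub> w"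
      using txy tyx by (simp_all add: w_def p_def q_def)
    \<comment> \<open>As \<open>p\<close> and \<open>q\<close> conjugate \<open>t\<close> to the same element, their quotient \<open>[x\<inverse>, y\<inverse>]\<close> fixes it.\<close>
    have qt: "inv\<^bsub>Q\<^esub> q \<otimes>\<^bsub>Q\<^esub> h t = w \<otimes>\<^bsub>Q\<^esub> inv\<^bsub>Q\<^esub> q"
      using tq wpq t
      by (metis h.H.inv_closed h.H.inv_solve_left h.H.inv_solve_right h.H.m_assoc h.H.m_closed h.hom_closed)
    have "h t \<otimes>\<^bsub>Q\<^esub> (p \<otimes>\<^bsub>Q\<^esub> inv\<^bsub>Q\<^esub> q) = p \<otimes>\<^bsub>Q\<^esub> (w \<otimes>\<^bsub>Q\<^esub> inv\<^bsub>Q\<^esub> q)"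
      using tp wpq t by (simp flip: h.H.m_assoc)
    also have "\<dots> = (p \<otimes>\<^bsub>Q\<^esub> inv\<^bsub>Q\<^esub> q) \<otimes>\<^bsub>Q\<^esub> h t"
      unfolding qt[symmetric] using wpq t by (simp add: h.H.m_assoc)
    also have "p \<otimes>\<^bsub>Q\<^esub> inv\<^bsub>Q\<^esub> q = h (commutator G (inv x) (inv y))"
      using cc by (simp add: commutator_def p_def q_def h.H.m_assoc h.H.inv_mult_group)
    finally show ?thesis unfolding ker using cc by (subst h.commutator_kernel_iff) auto
  qed
  note key = this
  have "commutator G t (commutator G x y) \<in> ?L"
    if x: "x \<in> lower_central G (Suc i)" and y: "y \<in> carrier G" for x y
  proof -
    have "inv x \<in> lower_central G (Suc i)"
      using x lower_central_normal normal_imp_subgroup subgroup.m_inv_closed by metis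
    then show ?thesis using key[of "inv x" "inv y"] x y lower_central_carrier by simp
  qed
  note gen = this
  have "x \<in> generate G {commutator G x y | x y. x \<in> lower_central G (Suc i) \<and> y \<in> carrier G}"
    using Suc.prems(3) by (simp add: commutator_subgroup_def)
  then show ?case
    by (rule commutator_generate_mem[OF L t, rotated 2]) (use gen lower_central_carrier in blast)+
qed

lemma (in group) commute_mult:
  assumes "a \<in> carrier G" "b \<in> carrier G" "z \<in> carrier G" "z \<otimes> a = a \<otimes> z" "z \<otimes> b = b \<otimes> z"
  shows "z \<otimes> (a \<otimes> b) = (a \<otimes> b) \<otimes> z"
proof -
  have "z \<otimes> (a \<otimes> b) = (a \<otimes> z) \<otimes> b" using assms by (simp flip: m_assoc)
  also have "\<dots> = a \<otimes> (b \<otimes> z)" using assms by (simp add: m_assoc)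
  finally show ?thesis using assms by (simp add: m_assoc)
qed

lemma (in group) commutator_perturb:
  assumes c: "a \<in> carrier G" "b \<in> carrier G" "z \<in> carrier G" "t \<in> carrier G"
    and z: "z \<otimes> a = a \<otimes> z" "z \<otimes> b = b \<otimes> z" "z \<otimes> t = t \<otimes> z"
    and t: "t \<otimes> (inv b \<otimes> a \<otimes> b) = (inv b \<otimes> a \<otimes> b) \<otimes> t"
  shows "commutator G (a \<otimes> z) (b \<otimes> t) = commutator G a b"
proof -
  define d where "d = inv b \<otimes> a \<otimes> b"
  have d: "d \<in> carrier G" using c by (simp add: d_def)
  have "z \<otimes> inv b = inv b \<otimes> z" using commute_inv[of b z] c z by simp
  then have zd: "z \<otimes> d = d \<otimes> z" unfolding d_def using c z by (intro commute_mult) auto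
  have za: "z \<otimes> inv a = inv a \<otimes> z" using commute_inv[of a z] c z by simp
  have "commutator G (a \<otimes> z) (b \<otimes> t) = inv z \<otimes> (inv a \<otimes> (inv t \<otimes> (inv b \<otimes> (a \<otimes> (z \<otimes> (b \<otimes> t))))))"
    using c by (simp add: commutator_def inv_mult_group m_assoc)
  also have "z \<otimes> (b \<otimes> t) = (b \<otimes> t) \<otimes> z" using c z by (intro commute_mult)
  also have "inv b \<otimes> (a \<otimes> (b \<otimes> t \<otimes> z)) = (d \<otimes> t) \<otimes> z" using c by (simp add: d_def m_assoc)
  also have "d \<otimes> t = t \<otimes> d" using t by (simp add: d_def)
  also have "inv t \<otimes> (t \<otimes> d \<otimes> z) = z \<otimes> d" using c d zd by (simp add: m_assoc)
  also have "inv a \<otimes> (z \<otimes> d) = z \<otimes> (inv a \<otimes> d)"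
    using za c d by (simp flip: m_assoc)
  finally show ?thesis using c d by (simp add: d_def commutator_def m_assoc)
qed

text \<open>Modulo \<open>[T, \<^bsub>i+1\<^esub> G]\<close> the elements of \<open>[T, \<^sub>i G]\<close> are central and those of \<open>T\<close> centralise
  \<open>\<gamma>\<^bsub>i+1\<^esub>(G)\<close>, which contains \<open>a\<close> and its conjugate by \<open>b\<close>.\<close>

lemma (in group) commutator_perturb_mod:
  fixes Q :: "'c monoid"
  assumes T: "T \<lhd> G" and "a \<in> lower_central G (Suc i)" "b \<in> carrier G"
    and "z \<in> iter_commutator G T (carrier G) i" "t \<in> T"
    and "group_hom G Q h"
    and ker: "iter_commutator G T (carrier G) (Suc i) = kernel G Q h"
  shows "h (commutator G (a \<otimes> z) (b \<otimes> t)) = h (commutator G a b)"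
proof -
  interpret h: group_hom G Q h by fact
  note c = assms(3) lower_central_carrier[OF assms(2)] iter_commutator_carrier[OF T assms(4)]
  have t: "t \<in> carrier G" using T assms(5) normal_imp_subgroup subgroup.mem_carrier by metis
  have comm: "h x \<otimes>\<^bsub>Q\<^esub> h y = h y \<otimes>\<^bsub>Q\<^esub> h x"
    if "commutator G x y \<in> iter_commutator G T (carrier G) (Suc i)"
      "x \<in> carrier G" "y \<in> carrier G" for x y
    using that h.commutator_kernel_iff unfolding ker by blast
  have z: "h z \<otimes>\<^bsub>Q\<^esub> h y = h y \<otimes>\<^bsub>Q\<^esub> h z" if "y \<in> carrier G" for y
    using that c assms(4) by (intro comm) (auto intro: commutator_mem)
  have tx: "h t \<otimes>\<^bsub>Q\<^esub> h x = h x \<otimes>\<^bsub>Q\<^esub> h t" if "x \<in> lower_central G (Suc i)" for x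
    using that t assms(5) T commutator_lower_central lower_central_carrier by (intro comm) blast+
  have "inv b \<otimes> a \<otimes> b \<in> lower_central G (Suc i)"
    using lower_central_normal assms(2,3) normal.inv_op_closed1 by metis
  from tx[OF this] have "h t \<otimes>\<^bsub>Q\<^esub> (inv\<^bsub>Q\<^esub> h b \<otimes>\<^bsub>Q\<^esub> h a \<otimes>\<^bsub>Q\<^esub> h b) = (inv\<^bsub>Q\<^esub> h b \<otimes>\<^bsub>Q\<^esub> h a \<otimes>\<^bsub>Q\<^esub> h b) \<otimes>\<^bsub>Q\<^esub> h t"
    using c by simp
  then have "commutator Q (h a \<otimes>\<^bsub>Q\<^esub> h z) (h b \<otimes>\<^bsub>Q\<^esub> h t) = commutator Q (h a) (h b)"
    using z tx[OF assms(2)] c t by (intro h.H.commutator_perturb) auto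
  then show ?thesis
    using c t h.hom_commutator[of "a \<otimes> z" "b \<otimes> t"] h.hom_commutator[of a b] by simp
qed

text \<open>The reason that the Baer invariant does not depend on choices of lifts.  A generator \<open>[x, y]\<close> of
  \<open>\<gamma>\<^bsub>i+2\<^esub>(F)\<close> has the images \<open>[\<psi> x z, \<psi> y t]\<close> under \<open>\<phi>\<close> and \<open>[\<psi> x, \<psi> y]\<close> under \<open>\<psi>\<close>, where \<open>z\<close> lies in
  \<open>[T, \<^sub>i K]\<close> by induction and \<open>t\<close> in \<open>T\<close>.  By the preceding lemma \<open>z\<close> and \<open>t\<close> make no difference modulo
  \<open>[T, \<^bsub>i+1\<^esub> K]\<close>.\<close>

lemma hom_agree_lower_central:
  fixes F :: "'f monoid" and K :: "'k monoid"
  assumes "group_hom F K \<phi>" "group_hom F K \<psi>" and T: "T \<lhd> K"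
    and agree: "\<And>x. x \<in> carrier F \<Longrightarrow> \<phi> x \<otimes>\<^bsub>K\<^esub> inv\<^bsub>K\<^esub> \<psi> x \<in> T"
    and "x \<in> lower_central F (Suc i)"
  shows "\<phi> x \<otimes>\<^bsub>K\<^esub> inv\<^bsub>K\<^esub> \<psi> x \<in> iter_commutator K T (carrier K) i"
  using assms(5)
proof (induction i arbitrary: x)
  case 0
  then show ?case using agree by simp
next
  case (Suc i)
  interpret \<phi>: group_hom F K \<phi> by fact
  interpret \<psi>: group_hom F K \<psi> by fact
  let ?L = "\<lambda>i. iter_commutator K T (carrier K) i"
  obtain Q :: "'k set monoid" and h where gh: "group_hom K Q h" and "h ` carrier K = carrier Q"
    and ker: "?L (Suc i) = kernel K Q h"
    by (rule normal_is_kernel[OF \<phi>.H.iter_commutator_normal[OF T, of "Suc i"]])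
  interpret h: group_hom K Q h by (rule gh)
  \<comment> \<open>The difference \<open>\<phi> x = \<psi> x \<otimes> z\<close> is wanted on the right, where normality moves it.\<close>
  have right: "\<exists>z\<in>M. \<phi> x = \<psi> x \<otimes>\<^bsub>K\<^esub> z"
    if "M \<lhd> K" "\<phi> x \<otimes>\<^bsub>K\<^esub> inv\<^bsub>K\<^esub> \<psi> x \<in> M" "x \<in> carrier F" for M x
  proof (rule bexI)
    show "\<phi> x = \<psi> x \<otimes>\<^bsub>K\<^esub> (inv\<^bsub>K\<^esub> \<psi> x \<otimes>\<^bsub>K\<^esub> (\<phi> x \<otimes>\<^bsub>K\<^esub> inv\<^bsub>K\<^esub> \<psi> x) \<otimes>\<^bsub>K\<^esub> \<psi> x)"
      using that(3) by (simp add: \<phi>.H.m_assoc)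
    show "inv\<^bsub>K\<^esub> \<psi> x \<otimes>\<^bsub>K\<^esub> (\<phi> x \<otimes>\<^bsub>K\<^esub> inv\<^bsub>K\<^esub> \<psi> x) \<otimes>\<^bsub>K\<^esub> \<psi> x \<in> M"
      using that by (intro normal.inv_op_closed1) auto
  qed
  have gen: "h (\<phi> (commutator F x y)) = h (\<psi> (commutator F x y))"
    if x: "x \<in> lower_central F (Suc i)" and y: "y \<in> carrier F" for x y
  proof -
    have xc: "x \<in> carrier F" using x by (rule \<phi>.G.lower_central_carrier)
    obtain z where z: "z \<in> ?L i" "\<phi> x = \<psi> x \<otimes>\<^bsub>K\<^esub> z"
      using right[OF \<phi>.H.iter_commutator_normal[OF T] Suc.IH[OF x] xc] by blast
    obtain t where t: "t \<in> T" "\<phi> y = \<psi> y \<otimes>\<^bsub>K\<^esub> t"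
      using right[OF T agree[OF y] y] by blast
    have "h (commutator K (\<psi> x \<otimes>\<^bsub>K\<^esub> z) (\<psi> y \<otimes>\<^bsub>K\<^esub> t)) = h (commutator K (\<psi> x) (\<psi> y))"
      using z(1) t(1) x y ker \<phi>.H.iter_commutator_carrier[OF T]
      by (intro \<phi>.H.commutator_perturb_mod[OF T _ _ _ _ h.group_hom_axioms, where i = i])
        (auto simp del: iter_commutator.simps lower_central.simps intro: \<psi>.hom_lower_central)
    then show ?thesis using xc y by (simp add: \<phi>.hom_commutator \<psi>.hom_commutator z(2) t(2))
  qed
  have "x \<in> generate F {commutator F x y | x y. x \<in> lower_central F (Suc i) \<and> y \<in> carrier F}"
    using Suc.prems by (simp add: commutator_subgroup_def)
  then have "x \<in> carrier F \<and> h (\<phi> x) = h (\<psi> x)"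
  proof induction
    case (incl a)
    then show ?case using gen \<phi>.G.lower_central_carrier \<phi>.G.commutator_closed by blast
  next
    case (inv a)
    then obtain x y where "a = commutator F x y" "x \<in> lower_central F (Suc i)" "y \<in> carrier F" by blast
    then show ?case using gen \<phi>.G.lower_central_carrier by simp
  qed simp_all
  then show ?case unfolding ker by (subst h.kernel_diff_iff) auto
qed

section \<open>Free groups and free products\<close>

lemma word_group_induct [consumes 1, case_names one letter]:
  assumes "x \<in> carrier (word_group S R)"
    and "P \<one>\<^bsub>word_group S R\<^esub>"
    and "\<And>s y. s \<in> S \<Longrightarrow> y \<in> carrier (word_group S R) \<Longrightarrow> P y \<Longrightarrow>
      P (word_cong S R `` {[s]} \<otimes>\<^bsub>word_group S R\<^esub> y)"
  shows "P x"
proof -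
  have "P (word_cong S R `` {u})" if "u \<in> lists S" for u
    using that
  proof induction
    case Nil
    then show ?case using assms(2) by (simp add: word_group_def)
  next
    case (Cons s u)
    then show ?case
      using assms(3)[of s "word_cong S R `` {u}"] word_group_mult[of "[s]" S u R]
      by (simp add: word_group_carrier)
  qed
  then show ?thesis using assms(1) unfolding word_group_carrier by blast
qed

lemma free_product_induct [consumes 1, case_names one inl inr]:
  assumes "x \<in> carrier (free_product G H)"
    and "P \<one>\<^bsub>free_product G H\<^esub>"
    and "\<And>a y. a \<in> carrier G \<Longrightarrow> y \<in> carrier (free_product G H) \<Longrightarrow> P y \<Longrightarrow>
      P (fp_inl G H a \<otimes>\<^bsub>free_product G H\<^esub> y)"
    and "\<And>b y. b \<in> carrier H \<Longrightarrow> y \<in> carrier (free_product G H) \<Longrightarrow> P y \<Longrightarrow>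
      P (fp_inr G H b \<otimes>\<^bsub>free_product G H\<^esub> y)"
  shows "P x"
  using assms(1)[unfolded free_product_def]
proof (induction rule: word_group_induct)
  case one
  then show ?case using assms(2) by (simp add: free_product_def)
next
  case (letter s y)
  from letter.hyps(1) show ?case
  proof
    fix a assume "s = Inl a" "a \<in> carrier G"
    then show ?thesis using assms(3) letter by (simp add: free_product_def fp_inl_def)
  next
    fix b assume "s = Inr b" "b \<in> carrier H"
    then show ?thesis using assms(4) letter by (simp add: free_product_def fp_inr_def)
  qed
qed

lemma free_product_hom_eqI:
  assumes "group G" "group H" "group L" "\<phi> \<in> hom (free_product G H) L" "\<psi> \<in> hom (free_product G H) L"
    and "\<And>a. a \<in> carrier G \<Longrightarrow> \<phi> (fp_inl G H a) = \<psi> (fp_inl G H a)"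
    and "\<And>b. b \<in> carrier H \<Longrightarrow> \<phi> (fp_inr G H b) = \<psi> (fp_inr G H b)"
    and "x \<in> carrier (free_product G H)"
  shows "\<phi> x = \<psi> x"
proof -
  let ?K = "free_product G H"
  have K: "group ?K" using assms(1,2) by (rule group_free_product)
  note inj = free_product_inj_hom[OF assms(1,2), THEN hom_in_carrier]
  show ?thesis using assms(8)
  proof (induction rule: free_product_induct)
    case one
    then show ?case using hom_one[OF assms(4) K assms(3)] hom_one[OF assms(5) K assms(3)] by simp
  next
    case (inl a y)
    then show ?case using inj(1) assms(6) hom_mult[OF assms(4)] hom_mult[OF assms(5)] by simp
  next
    case (inr b y)
    then show ?case using inj(2) assms(7) hom_mult[OF assms(4)] hom_mult[OF assms(5)] by simp
  qed
qed

definition free_group_gen :: "'x set \<Rightarrow> 'x \<Rightarrow> ('x \<times> bool) list set" where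
  "free_group_gen X x =
    word_cong (X \<times> UNIV) {([(x, e), (x, \<not> e)], []) | x e. x \<in> X} `` {[(x, True)]}"

lemma free_group_gen_closed: "x \<in> X \<Longrightarrow> free_group_gen X x \<in> carrier (free_group X)"
  unfolding free_group_gen_def free_group_def word_group_carrier by (intro imageI) simp

lemma free_group_induct [consumes 1, case_names one gen inv]:
  assumes "x \<in> carrier (free_group X)"
    and "P \<one>\<^bsub>free_group X\<^esub>"
    and "\<And>a y. a \<in> X \<Longrightarrow> y \<in> carrier (free_group X) \<Longrightarrow> P y \<Longrightarrow>
      P (free_group_gen X a \<otimes>\<^bsub>free_group X\<^esub> y)"
    and "\<And>a y. a \<in> X \<Longrightarrow> y \<in> carrier (free_group X) \<Longrightarrow> P y \<Longrightarrow>
      P (inv\<^bsub>free_group X\<^esub> (free_group_gen X a) \<otimes>\<^bsub>free_group X\<^esub> y)"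
  shows "P x"
proof -
  interpret F: group "free_group X" by (rule group_free_group)
  let ?S = "X \<times> (UNIV :: bool set)" and ?R = "{([(x, e), (x, \<not> e)], []) | x e. x \<in> X}"
  have inv: "word_cong ?S ?R `` {[(a, False)]} = inv\<^bsub>free_group X\<^esub> (free_group_gen X a)"
    if a: "a \<in> X" for a
  proof (rule F.inv_equality[symmetric])
    show "word_cong ?S ?R `` {[(a, False)]} \<in> carrier (free_group X)"
      unfolding free_group_def word_group_carrier using a by (intro imageI) simp
    have "word_cong ?S ?R `` {[(a, False), (a, True)]} = word_cong ?S ?R `` {[]}"
      using a by (intro word_group_rel) auto
    then show "word_cong ?S ?R `` {[(a, False)]} \<otimes>\<^bsub>free_group X\<^esub> free_group_gen X a = \<one>\<^bsub>free_group X\<^esub>"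
      using a word_group_mult[of "[(a, False)]" ?S "[(a, True)]" ?R]
      by (simp add: free_group_def free_group_gen_def) (simp add: word_group_def)
  qed (simp add: a free_group_gen_closed)
  show ?thesis using assms(1)[unfolded free_group_def]
  proof (induction rule: word_group_induct)
    case one
    then show ?case using assms(2) by (simp add: free_group_def)
  next
    case (letter s y)
    then obtain a e where s: "s = (a, e)" "a \<in> X" by auto
    show ?case
    proof (cases e)
      case True
      then show ?thesis
        using assms(3)[OF s(2), of y] letter s by (simp add: free_group_def free_group_gen_def)
    next
      case False
      then show ?thesis
        using assms(4)[OF s(2), of y] letter s inv[OF s(2)] by (simp add: free_group_def)
    qed
  qed
qed

text \<open>Free groups are projective: \<open>\<alpha>\<close> is built from preimages under \<open>\<epsilon>\<close> of the values of \<open>\<nu>\<close> on a basis.\<close>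

lemma free_group_lift:
  fixes F :: "'f monoid"
  assumes "is_free_group F" "group K" "group G" "\<epsilon> \<in> epi K G" "\<nu> \<in> hom F G"
  shows "\<exists>\<alpha>\<in>hom F K. \<forall>x\<in>carrier F. \<epsilon> (\<alpha> x) = \<nu> x"
proof -
  interpret K: group K by fact
  interpret G: group G by fact
  have F: "group F" using assms(1) by (simp add: is_free_group_def)
  obtain X :: "'f set" and i where i: "i \<in> iso F (free_group X)"
    using assms(1) by (auto simp: is_free_group_def is_iso_def)
  define j where "j = inv_into (carrier F) i"
  have j: "j \<in> iso (free_group X) F"
    unfolding j_def using F i by (rule group.iso_set_sym)
  have ji: "j (i x) = x" if "x \<in> carrier F" for x
    using i that by (simp add: j_def iso_def bij_betw_def)
  define \<mu> where "\<mu> = \<nu> \<circ> j"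
  have \<mu>: "\<mu> \<in> hom (free_group X) G"
    unfolding \<mu>_def using j assms(5) by (auto simp: iso_def intro: hom_compose)
  have eps: "\<epsilon> \<in> hom K G" "\<epsilon> ` carrier K = carrier G" using assms(4) by (auto simp: epi_def)
  interpret \<mu>: group_hom "free_group X" G \<mu>
    by (simp add: group_hom_def group_hom_axioms_def group_free_group assms(3) \<mu>)
  interpret \<epsilon>: group_hom K G \<epsilon>
    by (simp add: group_hom_def group_hom_axioms_def assms eps)
  have "\<forall>x\<in>X. \<exists>k\<in>carrier K. \<epsilon> k = \<mu> (free_group_gen X x)"
    using eps(2) free_group_gen_closed \<mu>.hom_closed by (metis image_iff)
  then obtain k where k: "\<And>x. x \<in> X \<Longrightarrow> k x \<in> carrier K"
    "\<And>x. x \<in> X \<Longrightarrow> \<epsilon> (k x) = \<mu> (free_group_gen X x)" by metis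
  have "\<exists>\<phi>\<in>hom (free_group X) K. \<forall>x\<in>X. \<phi> (free_group_gen X x) = k x"
    unfolding free_group_gen_def by (rule free_group_hom_exists[OF assms(2)]) (use k in auto)
  then obtain \<phi> where \<phi>: "\<phi> \<in> hom (free_group X) K" "\<And>x. x \<in> X \<Longrightarrow> \<phi> (free_group_gen X x) = k x"
    by blast
  interpret \<phi>: group_hom "free_group X" K \<phi>
    by (simp add: group_hom_def group_hom_axioms_def group_free_group assms(2) \<phi>)
  have eq: "\<epsilon> (\<phi> x) = \<mu> x" if "x \<in> carrier (free_group X)" for x
    using that by (induction rule: free_group_induct) (simp_all add: free_group_gen_closed k \<phi>(2))
  show ?thesis
  proof (rule bexI ballI)+
    show "\<phi> \<circ> i \<in> hom F K" using \<phi>(1) i by (auto simp: iso_def intro: hom_compose)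
    fix x assume "x \<in> carrier F"
    then show "\<epsilon> ((\<phi> \<circ> i) x) = \<nu> x"
      using eq[of "i x"] ji[of x] i by (auto simp: \<mu>_def iso_def hom_def)
  qed
qed

section \<open>Semidirect products\<close>

lemma (in group) complement_projection:
  assumes "A \<lhd> G" "subgroup B G" "A <#> B = carrier G" "A \<inter> B = {\<one>}"
  shows "\<exists>p\<in>hom G (G\<lparr>carrier := B\<rparr>). \<forall>a\<in>A. \<forall>b\<in>B. p (a \<otimes> b) = b"
proof -
  interpret A: normal A G by fact
  interpret group_disjoint_sum G A B
    using assms by (auto simp: group_disjoint_sum_def intro: normal_imp_subgroup is_group)
  define p where "p g = (THE b. b \<in> B \<and> (\<exists>a\<in>A. g = a \<otimes> b))" for g
  have p: "p (a \<otimes> b) = b" if "a \<in> A" "b \<in> B" for a b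
    unfolding p_def using that cancel assms(4) by (intro the_equality) (metis subset_refl)+
  have dec: "\<exists>a\<in>A. \<exists>b\<in>B. g = a \<otimes> b" if "g \<in> carrier G" for g
    using that unfolding assms(3)[symmetric] set_mult_def by blast
  show ?thesis
  proof (intro bexI ballI)
    show "p \<in> hom G (G\<lparr>carrier := B\<rparr>)"
    proof (rule homI)
      fix x y assume "x \<in> carrier G" "y \<in> carrier G"
      then obtain a b a' b' where ab: "a \<in> A" "b \<in> B" "x = a \<otimes> b" "a' \<in> A" "b' \<in> B" "y = a' \<otimes> b'"
        using dec by metis
      show "p x \<in> carrier (G\<lparr>carrier := B\<rparr>)" using p ab by simp
      have "x \<otimes> y = (a \<otimes> (b \<otimes> a' \<otimes> inv b)) \<otimes> (b \<otimes> b')"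
        using ab by (simp add: m_assoc)
      moreover have "b \<otimes> a' \<otimes> inv b \<in> A" using ab A.inv_op_closed2 by simp
      ultimately have "p (x \<otimes> y) = b \<otimes> b'"
        using ab p[of "a \<otimes> (b \<otimes> a' \<otimes> inv b)" "b \<otimes> b'"] by simp
      then show "p (x \<otimes> y) = p x \<otimes>\<^bsub>G\<lparr>carrier := B\<rparr>\<^esub> p y" using p ab by simp
    qed
  qed (rule p)
qed

lemma (in group) conj_eq_if_relator:
  assumes "r \<in> carrier G" "s \<in> carrier G" "u \<in> carrier G"
    and "inv r \<otimes> s \<otimes> (u \<otimes> inv r \<otimes> inv u \<otimes> r) = \<one>"
  shows "s \<otimes> u = u \<otimes> r"
proof -
  define w where "w = u \<otimes> r \<otimes> inv u"
  have w: "w \<in> carrier G" using assms by (simp add: w_def)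
  have "inv r \<otimes> ((s \<otimes> inv w) \<otimes> r) = \<one>"
    using assms by (simp add: w_def inv_mult_group m_assoc)
  then have "(s \<otimes> inv w) \<otimes> r = r"
    using assms(1,2) w inv_mult_cancel_left(2)[of r "(s \<otimes> inv w) \<otimes> r"] by simp
  then have "s \<otimes> inv w = \<one>" using assms(1,2) w r_cancel_one[of r "s \<otimes> inv w"] by simp
  then have "s = w" using inv_equality[of s "inv w"] assms(2) w by simp
  then show ?thesis using assms(1,3) by (simp add: w_def m_assoc)
qed

lemma semidirect_free_product_epi:
  assumes sd: "semidirect_product G A B \<theta>" and fp: "free_presentation F \<nu> (G\<lparr>carrier := A\<rparr>)"
  obtains \<kappa> where "\<kappa> \<in> epi (free_product F (G\<lparr>carrier := B\<rparr>)) G"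
    "\<And>f. f \<in> carrier F \<Longrightarrow> \<kappa> (fp_inl F (G\<lparr>carrier := B\<rparr>) f) = \<nu> f"
    "\<And>b. b \<in> B \<Longrightarrow> \<kappa> (fp_inr F (G\<lparr>carrier := B\<rparr>) b) = b"
proof -
  let ?B = "G\<lparr>carrier := B\<rparr>" let ?K = "free_product F ?B"
  note sdd = sd[unfolded semidirect_product_def]
  interpret A: normal A G using sdd by simp
  interpret B: subgroup B G using sdd by simp
  have gF: "group F" using fp by (simp add: free_presentation_def is_free_group_def)
  have gB: "group ?B" using A.is_group B.subgroup_is_group by blast
  have \<nu>: "\<nu> \<in> hom F G" "\<nu> ` carrier F = A"
    using fp A.subset by (auto simp: free_presentation_def epi_def hom_def)
  have id: "(\<lambda>x. x) \<in> hom ?B G" using B.subset by (auto simp: hom_def)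
  have "\<exists>\<kappa>\<in>hom ?K G. (\<forall>f\<in>carrier F. \<kappa> (fp_inl F ?B f) = \<nu> f) \<and> (\<forall>b\<in>B. \<kappa> (fp_inr F ?B b) = b)"
    using free_product_hom_exists[OF gF gB A.is_group \<nu>(1) id] by simp
  then obtain \<kappa> where \<kappa>: "\<kappa> \<in> hom ?K G"
    "\<And>f. f \<in> carrier F \<Longrightarrow> \<kappa> (fp_inl F ?B f) = \<nu> f" "\<And>b. b \<in> B \<Longrightarrow> \<kappa> (fp_inr F ?B b) = b"
    by blast
  have "g \<in> \<kappa> ` carrier ?K" if g: "g \<in> carrier G" for g
  proof -
    obtain a b where ab: "a \<in> A" "b \<in> B" "g = a \<otimes>\<^bsub>G\<^esub> b"
      using g sdd unfolding set_mult_def by blast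
    obtain f where f: "f \<in> carrier F" "\<nu> f = a" using ab(1) \<nu>(2) by blast
    have i: "fp_inl F ?B f \<in> carrier ?K" and j: "fp_inr F ?B b \<in> carrier ?K"
      using free_product_inj_hom[OF gF gB] f(1) ab(2) by (auto simp: hom_def)
    have "\<kappa> (fp_inl F ?B f \<otimes>\<^bsub>?K\<^esub> fp_inr F ?B b) = g"
      using hom_mult[OF \<kappa>(1) i j] \<kappa>(2)[OF f(1)] \<kappa>(3)[OF ab(2)] f ab by simp
    moreover have "fp_inl F ?B f \<otimes>\<^bsub>?K\<^esub> fp_inr F ?B b \<in> carrier ?K"
      using i j group_free_product[OF gF gB] by (simp add: group.is_monoid monoid.m_closed)
    ultimately show ?thesis by blast
  qed
  then have "\<kappa> ` carrier ?K = carrier G" using hom_carrier[OF \<kappa>(1)] by blast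
  then have "\<kappa> \<in> epi ?K G" unfolding epi_def using \<kappa>(1) by blast
  then show ?thesis using that \<kappa>(2,3) by blast
qed

text \<open>Modulo \<open>T\<close>, conjugation by \<open>b \<in> B\<close> maps \<open>F\<close> into itself the way \<open>\<theta>(b)\<close> maps \<open>A\<close>.  Hence every element
  of \<open>K\<close> is congruent to some \<open>f b\<close>, and it lies over \<open>\<nu>(f) b\<close>; if that is trivial, then \<open>b = 1\<close>
  and \<open>\<nu>(f) = 1\<close>, and \<open>f\<close> is itself one of the generators of \<open>T\<close>.\<close>

lemma T_subgroup_eq_kernel:
  fixes F :: "'f monoid" and G :: "'a monoid"
  assumes sd: "semidirect_product G A B \<theta>" and fp: "free_presentation F \<nu> (G\<lparr>carrier := A\<rparr>)"
    and \<kappa>: "\<kappa> \<in> hom (free_product F (G\<lparr>carrier := B\<rparr>)) G"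
      "\<And>f. f \<in> carrier F \<Longrightarrow> \<kappa> (fp_inl F (G\<lparr>carrier := B\<rparr>) f) = \<nu> f"
      "\<And>b. b \<in> B \<Longrightarrow> \<kappa> (fp_inr F (G\<lparr>carrier := B\<rparr>) b) = b"
  shows "T_subgroup F \<nu> (G\<lparr>carrier := B\<rparr>) \<theta> = kernel (free_product F (G\<lparr>carrier := B\<rparr>)) G \<kappa>"
proof -
  let ?B = "G\<lparr>carrier := B\<rparr>"
  define K where "K = free_product F ?B"
  define i where "i = fp_inl F ?B"
  define j where "j = fp_inr F ?B"
  define gens where "gens = {inv\<^bsub>K\<^esub> (i f) \<otimes>\<^bsub>K\<^esub> i f' \<otimes>\<^bsub>K\<^esub> commutator K (j b) (i f) | f f' b.
          f \<in> carrier F \<and> f' \<in> carrier F \<and> b \<in> B \<and> \<nu> f' = \<theta> b (\<nu> f)}"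
  have T: "T_subgroup F \<nu> ?B \<theta> = normal_closure K gens"
    by (simp add: T_subgroup_def Let_def K_def i_def j_def gens_def)
  note sdd = sd[unfolded semidirect_product_def]
  interpret A: normal A G using sdd by simp
  interpret B: subgroup B G using sdd by simp
  have gF: "group F" using fp by (simp add: free_presentation_def is_free_group_def)
  have gB: "group ?B" using A.is_group B.subgroup_is_group by blast
  interpret \<nu>: group_hom F "G\<lparr>carrier := A\<rparr>" \<nu>
    using fp gF by (simp add: free_presentation_def group_hom_def group_hom_axioms_def epi_def)
  have \<nu>onto: "\<exists>f\<in>carrier F. \<nu> f = a" if "a \<in> A" for a
    using fp that by (auto simp: free_presentation_def epi_def image_iff)
  have \<nu>A: "\<nu> f \<in> A" if "f \<in> carrier F" for f using \<nu>.hom_closed[OF that] by simp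
  have gK: "group K" unfolding K_def using gF gB by (rule group_free_product)
  interpret K: group K by (rule gK)
  interpret i: group_hom F K i
    using free_product_inj_hom(1)[OF gF gB] gF gK
    by (simp add: group_hom_def group_hom_axioms_def K_def i_def)
  interpret j: group_hom ?B K j
    using free_product_inj_hom(2)[OF gF gB] gB gK
    by (simp add: group_hom_def group_hom_axioms_def K_def j_def)
  interpret \<kappa>: group_hom K G \<kappa>
    using \<kappa>(1) gK A.is_group by (simp add: group_hom_def group_hom_axioms_def K_def)
  have \<kappa>i: "\<kappa> (i f) = \<nu> f" if "f \<in> carrier F" for f using \<kappa>(2) that by (simp add: i_def)
  have \<kappa>j: "\<kappa> (j b) = b" if "b \<in> B" for b using \<kappa>(3) that by (simp add: j_def)
  have jc: "j b \<in> carrier K" if "b \<in> B" for b using j.hom_closed that by simp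
  have \<theta>: "\<theta> b a = inv\<^bsub>G\<^esub> b \<otimes>\<^bsub>G\<^esub> a \<otimes>\<^bsub>G\<^esub> b" if "b \<in> B" "a \<in> A" for a b using sdd that by simp
  have \<theta>A: "\<theta> b a \<in> A" if "b \<in> B" "a \<in> A" for a b using \<theta> that A.inv_op_closed1 by simp
  have "gens \<subseteq> kernel K G \<kappa>"
  proof
    fix x assume "x \<in> gens"
    then obtain f f' b where x: "x = inv\<^bsub>K\<^esub> (i f) \<otimes>\<^bsub>K\<^esub> i f' \<otimes>\<^bsub>K\<^esub> commutator K (j b) (i f)"
      and f: "f \<in> carrier F" "f' \<in> carrier F" "b \<in> B" "\<nu> f' = \<theta> b (\<nu> f)" unfolding gens_def by blast
    have "\<kappa> x = inv\<^bsub>G\<^esub> (\<nu> f) \<otimes>\<^bsub>G\<^esub> \<theta> b (\<nu> f) \<otimes>\<^bsub>G\<^esub> commutator G b (\<nu> f)"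
      using f jc by (simp add: x \<kappa>i \<kappa>j \<kappa>.hom_commutator)
    also have "\<dots> = \<one>\<^bsub>G\<^esub>"
      using f \<nu>A by (simp add: \<theta> commutator_def A.m_assoc)
    finally show "x \<in> kernel K G \<kappa>" using f jc by (subst \<kappa>.kernel_iff) (auto simp: x)
  qed
  then have le: "normal_closure K gens \<subseteq> kernel K G \<kappa>"
    unfolding normal_closure_def using \<kappa>.normal_kernel by blast
  have mem: "x \<in> N" if N: "N \<lhd> K" "gens \<subseteq> N" "N \<subseteq> kernel K G \<kappa>" and x: "x \<in> kernel K G \<kappa>" for x N
  proof -
    obtain Q :: "('f + 'a) list set set monoid" and h where gh: "group_hom K Q h"
      and "h ` carrier K = carrier Q" and ker: "N = kernel K Q h"
      by (rule normal_is_kernel[OF N(1)])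
    interpret h: group_hom K Q h by (rule gh)
    \<comment> \<open>The generator is taken for \<open>b\<inverse>\<close>: \<open>\<theta> b\<close> describes \<open>b\<inverse> f b\<close>, but \<open>b f b\<inverse>\<close> is needed.\<close>
    have swap: "\<exists>f'\<in>carrier F. h (j b) \<otimes>\<^bsub>Q\<^esub> h (i f) = h (i f') \<otimes>\<^bsub>Q\<^esub> h (j b)"
      if f: "f \<in> carrier F" and b: "b \<in> B" for f b
    proof -
      have b': "inv\<^bsub>G\<^esub> b \<in> B" using b by simp
      obtain f' where f': "f' \<in> carrier F" "\<nu> f' = \<theta> (inv\<^bsub>G\<^esub> b) (\<nu> f)"
        using \<nu>onto \<theta>A[OF b' \<nu>A[OF f]] by metis
      have jb: "j (inv\<^bsub>G\<^esub> b) = inv\<^bsub>K\<^esub> j b"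
        using j.hom_inv[of b] b B.subgroup_axioms A.m_inv_consistent by simp
      have "inv\<^bsub>K\<^esub> (i f) \<otimes>\<^bsub>K\<^esub> i f' \<otimes>\<^bsub>K\<^esub> commutator K (j (inv\<^bsub>G\<^esub> b)) (i f) \<in> kernel K Q h"
        using N(2) f f' b' unfolding gens_def ker by blast
      then have "inv\<^bsub>Q\<^esub> h (i f) \<otimes>\<^bsub>Q\<^esub> h (i f') \<otimes>\<^bsub>Q\<^esub> (h (j b) \<otimes>\<^bsub>Q\<^esub> inv\<^bsub>Q\<^esub> h (i f) \<otimes>\<^bsub>Q\<^esub> inv\<^bsub>Q\<^esub> h (j b) \<otimes>\<^bsub>Q\<^esub> h (i f))
          = \<one>\<^bsub>Q\<^esub>"
        using f f' jc[OF b] by (simp add: kernel_def commutator_def jb)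
      then have "h (i f') \<otimes>\<^bsub>Q\<^esub> h (j b) = h (j b) \<otimes>\<^bsub>Q\<^esub> h (i f)"
        using f f' jc[OF b] by (intro h.H.conj_eq_if_relator) auto
      then show ?thesis using f' by metis
    qed
    have "x \<in> carrier K" using x by (simp add: kernel_def)
    then have "\<exists>f\<in>carrier F. \<exists>b\<in>B. h x = h (i f) \<otimes>\<^bsub>Q\<^esub> h (j b)"
      unfolding K_def
    proof (induction rule: free_product_induct)
      case one
      have "h \<one>\<^bsub>K\<^esub> = h (i \<one>\<^bsub>F\<^esub>) \<otimes>\<^bsub>Q\<^esub> h (j \<one>\<^bsub>G\<^esub>)"
        using j.hom_one by simp
      then show ?case unfolding K_def by (intro bexI[of _ "\<one>\<^bsub>F\<^esub>"] bexI[of _ "\<one>\<^bsub>G\<^esub>"]) auto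
    next
      case (inl a y)
      then obtain f b where fb: "f \<in> carrier F" "b \<in> B" "h y = h (i f) \<otimes>\<^bsub>Q\<^esub> h (j b)" by blast
      have "h (i a \<otimes>\<^bsub>K\<^esub> y) = h (i (a \<otimes>\<^bsub>F\<^esub> f)) \<otimes>\<^bsub>Q\<^esub> h (j b)"
        using inl fb jc by (simp add: h.H.m_assoc flip: K_def)
      then show ?case unfolding K_def i_def using inl(1) fb
        by (intro bexI[of _ "a \<otimes>\<^bsub>F\<^esub> f"] bexI[of _ b]) auto
    next
      case (inr c y)
      then obtain f b where fb: "f \<in> carrier F" "b \<in> B" "h y = h (i f) \<otimes>\<^bsub>Q\<^esub> h (j b)" by blast
      have c: "c \<in> B" using inr by simp
      obtain f' where f': "f' \<in> carrier F" "h (j c) \<otimes>\<^bsub>Q\<^esub> h (i f) = h (i f') \<otimes>\<^bsub>Q\<^esub> h (j c)"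
        using swap[OF fb(1) c] by blast
      have "h (j c \<otimes>\<^bsub>K\<^esub> y) = (h (j c) \<otimes>\<^bsub>Q\<^esub> h (i f)) \<otimes>\<^bsub>Q\<^esub> h (j b)"
        using inr fb jc c by (simp add: h.H.m_assoc flip: K_def)
      also have "\<dots> = h (i f') \<otimes>\<^bsub>Q\<^esub> h (j (c \<otimes>\<^bsub>G\<^esub> b))"
        unfolding f' using f' jc c fb j.hom_mult[of c b] by (simp add: h.H.m_assoc)
      finally show ?case unfolding K_def j_def using c f' fb
        by (intro bexI[of _ f'] bexI[of _ "c \<otimes>\<^bsub>G\<^esub> b"]) auto
    qed
    then obtain f b where fb: "f \<in> carrier F" "b \<in> B" "h x = h (i f \<otimes>\<^bsub>K\<^esub> j b)"
      using jc by auto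
    define y where "y = i f \<otimes>\<^bsub>K\<^esub> j b"
    have xy: "x \<in> carrier K" "y \<in> carrier K" using x fb jc by (auto simp: kernel_def y_def)
    have diff: "x \<otimes>\<^bsub>K\<^esub> inv\<^bsub>K\<^esub> y \<in> N"
      unfolding ker using xy fb(3) by (subst h.kernel_diff_iff) (auto simp: y_def)
    then have "\<kappa> y = \<kappa> x" using N(3) \<kappa>.kernel_diff_iff[OF xy] by auto
    then have "\<nu> f \<otimes>\<^bsub>G\<^esub> b = \<one>\<^bsub>G\<^esub>" using x fb jc by (simp add: y_def \<kappa>i \<kappa>j kernel_def)
    moreover have "group_disjoint_sum G A B"
      by (intro group_disjoint_sum.intro A.is_group A.subgroup_axioms B.subgroup_axioms)
    ultimately have triv: "\<nu> f = \<one>\<^bsub>G\<^esub>" "b = \<one>\<^bsub>G\<^esub>"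
      using group_disjoint_sum.sub_id_iff[of G A B] sdd \<nu>A[OF fb(1)] fb(2) by auto
    have "inv\<^bsub>K\<^esub> (i \<one>\<^bsub>F\<^esub>) \<otimes>\<^bsub>K\<^esub> i f \<otimes>\<^bsub>K\<^esub> commutator K (j \<one>\<^bsub>G\<^esub>) (i \<one>\<^bsub>F\<^esub>) \<in> gens"
      unfolding gens_def using fb triv \<nu>.hom_one \<theta>[of "\<one>\<^bsub>G\<^esub>" "\<one>\<^bsub>G\<^esub>"]
      by (intro CollectI exI[of _ "\<one>\<^bsub>F\<^esub>"] exI[of _ f] exI[of _ "\<one>\<^bsub>G\<^esub>"]) auto
    moreover have "j \<one>\<^bsub>G\<^esub> = \<one>\<^bsub>K\<^esub>" using j.hom_one by simp
    ultimately have "y \<in> N" using N(2) fb triv by (auto simp: y_def commutator_def)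
    then have "x \<otimes>\<^bsub>K\<^esub> inv\<^bsub>K\<^esub> y \<otimes>\<^bsub>K\<^esub> y \<in> N"
      using diff N(1) normal_imp_subgroup subgroup.m_closed by metis
    then show ?thesis using xy by (simp add: K.m_assoc)
  qed
  have "x \<in> N" if "N \<lhd> K" "gens \<subseteq> N" "x \<in> kernel K G \<kappa>" for x N
    using mem[of "N \<inter> kernel K G \<kappa>" x] K.normal_subgroup_intersect[OF that(1) \<kappa>.normal_kernel]
      that \<open>gens \<subseteq> kernel K G \<kappa>\<close> by blast
  then show ?thesis unfolding T using le by (auto simp: normal_closure_def K_def)
qed

section \<open>Finiteness of the Baer invariant of a finite group\<close>

text \<open>A finite set of representatives, instead of a finite set of cosets, is mapped by a homomorphism to a
  set of representatives of the images.\<close>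

definition finite_index_mod :: "('a, 'm) monoid_scheme \<Rightarrow> 'a set \<Rightarrow> 'a set \<Rightarrow> bool" where
  "finite_index_mod G X L \<longleftrightarrow>
    (\<exists>Y. finite Y \<and> Y \<subseteq> carrier G \<and> (\<forall>x\<in>X. \<exists>y\<in>Y. \<exists>z\<in>L. x = y \<otimes>\<^bsub>G\<^esub> z))"

lemma (in group_hom) finite_index_mod_kernel:
  assumes "X \<subseteq> carrier G" "finite (h ` X)"
  shows "finite_index_mod G X (kernel G H h)"
proof -
  obtain Y where Y: "Y \<subseteq> X" "finite Y" "h ` X = h ` Y"
    using finite_subset_image[OF assms(2) subset_refl] by blast
  have "\<exists>y\<in>Y. \<exists>z\<in>kernel G H h. x = y \<otimes> z" if x: "x \<in> X" for x
  proof -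
    obtain y where y: "y \<in> Y" "h x = h y" using Y(3) x by blast
    have c: "x \<in> carrier G" "y \<in> carrier G" using x y Y assms by auto
    then have "inv y \<otimes> x \<in> kernel G H h" using y by (simp add: kernel_iff)
    then show ?thesis using c y(1) by (intro bexI[of _ y] bexI[of _ "inv y \<otimes> x"]) auto
  qed
  then show ?thesis unfolding finite_index_mod_def using Y assms(1) by blast
qed

lemma (in group_hom) finite_index_mod_image:
  assumes "finite_index_mod G X L" "L \<subseteq> carrier G"
  shows "finite_index_mod H (h ` X) (h ` L)"
proof -
  obtain Y where Y: "finite Y" "Y \<subseteq> carrier G" "\<forall>x\<in>X. \<exists>y\<in>Y. \<exists>z\<in>L. x = y \<otimes> z"
    using assms(1) unfolding finite_index_mod_def by blast
  have "\<exists>y\<in>h ` Y. \<exists>z\<in>h ` L. x = y \<otimes>\<^bsub>H\<^esub> z" if x: "x \<in> h ` X" for x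
  proof -
    obtain x' where x': "x' \<in> X" "x = h x'" using x by blast
    then obtain y z where "y \<in> Y" "z \<in> L" "x' = y \<otimes> z" using Y(3) by blast
    then have "h y \<in> h ` Y" "h z \<in> h ` L" "x = h y \<otimes>\<^bsub>H\<^esub> h z"
      using x'(2) Y(2) assms(2) by (auto simp: subset_iff)
    then show ?thesis by blast
  qed
  then show ?thesis unfolding finite_index_mod_def using Y by (intro exI[of _ "h ` Y"]) auto
qed

lemma (in group) conj_nat_pow:
  fixes m :: nat
  assumes "g \<in> carrier G" "w \<in> carrier G"
  shows "(g \<otimes> w \<otimes> inv g) [^] m = g \<otimes> w [^] m \<otimes> inv g"
  using assms by (induction m) (simp_all add: m_assoc)

text \<open>Schur's trick: a power \<open>w\<^bsup>n+1\<^esup>\<close> of \<open>w = [a, b]\<close> is a product of only \<open>n = m + 1\<close> commutators if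
  \<open>w\<^bsup>n\<^esup>\<close> is central.  Write \<open>w = a\<inverse> e\<close> with \<open>e = b\<inverse> a b\<close>.  Moving the central power past \<open>e\<close> gives
  \<open>w\<^bsup>n+1\<^esup> = a\<inverse> w\<^bsup>n\<^esup> e = a\<inverse> a\<inverse> e w\<^bsup>m\<^esup> e\<close>.  With \<open>g = (a a)\<inverse> e\<close> this is \<open>g w\<^bsup>m\<^esup> g\<inverse>\<close> times
  \<open>(a a)\<inverse> e e = [a a, b]\<close>.\<close>

lemma (in group) commutator_pow_shorten:
  fixes m :: nat
  assumes ab: "a \<in> carrier G" "b \<in> carrier G"
    and central: "\<And>g. g \<in> carrier G \<Longrightarrow>
      g \<otimes> commutator G a b [^] Suc m = commutator G a b [^] Suc m \<otimes> g"
    and g: "g = inv (a \<otimes> a) \<otimes> (inv b \<otimes> a \<otimes> b)"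
  shows "commutator G a b [^] Suc (Suc m)
    = (g \<otimes> commutator G a b \<otimes> inv g) [^] m \<otimes> commutator G (a \<otimes> a) b"
proof -
  define w where "w = commutator G a b"
  define e where "e = inv b \<otimes> a \<otimes> b"
  have c: "w \<in> carrier G" "e \<in> carrier G" "g \<in> carrier G" "w [^] m \<in> carrier G"
    using ab by (simp_all add: w_def e_def g)
  have w: "w = inv a \<otimes> e" using ab by (simp add: w_def e_def commutator_def m_assoc)
  have "w [^] Suc (Suc m) = w \<otimes> w [^] Suc m"
    using c(1) by (metis nat_pow_Suc2)
  also have "\<dots> = inv a \<otimes> (e \<otimes> w [^] Suc m)"
    using ab c by (simp add: w m_assoc del: nat_pow_Suc)
  also have "e \<otimes> w [^] Suc m = w [^] Suc m \<otimes> e"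
    unfolding w_def by (rule central) (rule c)
  also have "w [^] Suc m = w \<otimes> w [^] m"
    using c(1) by (metis nat_pow_Suc2)
  finally have 1: "w [^] Suc (Suc m) = inv a \<otimes> (inv a \<otimes> (e \<otimes> (w [^] m \<otimes> e)))"
    using ab c by (subst (asm) (2) w) (simp add: m_assoc)
  have "commutator G (a \<otimes> a) b = inv (a \<otimes> a) \<otimes> (e \<otimes> e)"
    using ab by (simp add: commutator_def e_def m_assoc)
  moreover have "inv g = inv e \<otimes> (a \<otimes> a)"
    using ab by (simp add: g e_def inv_mult_group m_assoc)
  ultimately have "(g \<otimes> w \<otimes> inv g) [^] m \<otimes> commutator G (a \<otimes> a) b
      = (g \<otimes> w [^] m \<otimes> (inv e \<otimes> (a \<otimes> a))) \<otimes> (inv (a \<otimes> a) \<otimes> (e \<otimes> e))"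
    using conj_nat_pow[OF c(3,1), of m] by simp
  also have "\<dots> = inv a \<otimes> (inv a \<otimes> (e \<otimes> (w [^] m \<otimes> e)))"
    using ab c by (simp add: g m_assoc inv_mult_group flip: e_def)
  finally show ?thesis using 1 by (simp add: w_def)
qed

definition list_prod :: "('a, 'm) monoid_scheme \<Rightarrow> 'a list \<Rightarrow> 'a" where
  "list_prod G xs = foldr (\<lambda>x y. x \<otimes>\<^bsub>G\<^esub> y) xs \<one>\<^bsub>G\<^esub>"

lemma (in group) list_prod_simps [simp]:
  "list_prod G [] = \<one>" "list_prod G (x # xs) = x \<otimes> list_prod G xs"
  by (simp_all add: list_prod_def)

lemma (in group) list_prod_closed [simp, intro]:
  "set xs \<subseteq> carrier G \<Longrightarrow> list_prod G xs \<in> carrier G"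
  by (induction xs) auto

lemma (in group) list_prod_append:
  "set xs \<subseteq> carrier G \<Longrightarrow> set ys \<subseteq> carrier G \<Longrightarrow>
    list_prod G (xs @ ys) = list_prod G xs \<otimes> list_prod G ys"
  by (induction xs) (auto simp: m_assoc)

lemma (in group) list_prod_replicate:
  "w \<in> carrier G \<Longrightarrow> list_prod G (replicate n w) = w [^] n"
proof (induction n)
  case (Suc n)
  then show ?case using nat_pow_Suc2[of w n] by simp
qed simp

lemma (in group) list_prod_collect:
  assumes S: "S \<subseteq> carrier G" "\<And>g s. g \<in> carrier G \<Longrightarrow> s \<in> S \<Longrightarrow> g \<otimes> s \<otimes> inv g \<in> S"
    and w: "w \<in> carrier G" and "set l \<subseteq> S"
  shows "\<exists>l'. set l' \<subseteq> S \<and> length l' + count_list l w = length l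
    \<and> list_prod G l = w [^] count_list l w \<otimes> list_prod G l'"
  using assms(4)
proof (induction l)
  case Nil
  then show ?case by (intro exI[of _ "[]"]) simp
next
  case (Cons a l)
  then obtain l' where l': "set l' \<subseteq> S" "length l' + count_list l w = length l"
    "list_prod G l = w [^] count_list l w \<otimes> list_prod G l'" by auto
  have c: "a \<in> carrier G" "list_prod G l' \<in> carrier G" using Cons.prems l'(1) S(1) by auto
  define p where "p = w [^] count_list l w"
  have p: "p \<in> carrier G" using w by (simp add: p_def)
  show ?case
  proof (cases "a = w")
    case True
    have "w \<otimes> p = w [^] Suc (count_list l w)" using w unfolding p_def by (metis nat_pow_Suc2)
    then have "w \<otimes> list_prod G l = w [^] Suc (count_list l w) \<otimes> list_prod G l'"
      using l'(3) w c p by (simp add: m_assoc[symmetric] flip: p_def)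
    then show ?thesis using True l' by (intro exI[of _ l']) simp
  next
    case False
    have "inv p \<otimes> a \<otimes> p \<in> S" using S(2)[of "inv p" a] p Cons.prems by simp
    moreover have "a \<otimes> list_prod G l = p \<otimes> ((inv p \<otimes> a \<otimes> p) \<otimes> list_prod G l')"
      using l'(3) c p by (simp add: m_assoc flip: p_def)
    ultimately show ?thesis using False l' p_def
      by (intro exI[of _ "(inv p \<otimes> a \<otimes> p) # l'"]) simp
  qed
qed

text \<open>In a product of more than \<open>card S * n\<close> factors some \<open>w \<in> S\<close> occurs more than \<open>n\<close>
  times.  Its occurrences can be moved to the front, conjugating the factors that they pass, and then \<open>w\<^bsup>n+1\<^esup>\<close> can be shortened.  So products of bounded
  length exhaust the group generated by \<open>S\<close>.\<close>

lemma (in group) finite_generate_if_powers_shorten: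
  assumes S: "S \<subseteq> carrier G" "finite S" "\<And>g s. g \<in> carrier G \<Longrightarrow> s \<in> S \<Longrightarrow> g \<otimes> s \<otimes> inv g \<in> S"
    and inv: "\<And>s. s \<in> S \<Longrightarrow> inv s \<in> S"
    and short: "\<And>w. w \<in> S \<Longrightarrow> \<exists>l. set l \<subseteq> S \<and> length l \<le> n \<and> w [^] Suc n = list_prod G l"
  shows "finite (generate G S)"
proof -
  have bounded: "\<exists>l'. set l' \<subseteq> S \<and> length l' \<le> card S * n \<and> list_prod G l = list_prod G l'"
    if "set l \<subseteq> S" for l
    using that
  proof (induction "length l" arbitrary: l rule: less_induct)
    case less
    show ?case
    proof (cases "length l \<le> card S * n")
      case True
      then show ?thesis using less.prems by blast
    next
      case False
      have "\<exists>w\<in>S. count_list l w > n"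
      proof (rule ccontr)
        assume "\<not> (\<exists>w\<in>S. count_list l w > n)"
        then have "(\<Sum>w\<in>S. count_list l w) \<le> (\<Sum>w\<in>S. n)" by (intro sum_mono) auto
        then show False using False sum_count_set[OF less.prems S(2)] by simp
      qed
      then obtain w where w: "w \<in> S" "count_list l w > n" by blast
      have wc: "w \<in> carrier G" using w(1) S(1) by blast
      obtain l1 where l1: "set l1 \<subseteq> S" "length l1 + count_list l w = length l"
        "list_prod G l = w [^] count_list l w \<otimes> list_prod G l1"
        using list_prod_collect[OF S(1,3) wc less.prems] by blast
      obtain l0 where l0: "set l0 \<subseteq> S" "length l0 \<le> n" "w [^] Suc n = list_prod G l0"
        using short[OF w(1)] by blast
      define k where "k = count_list l w - Suc n"
      have k: "count_list l w = Suc n + k" using w(2) by (simp add: k_def)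
      let ?l = "l0 @ replicate k w @ l1"
      have s: "set ?l \<subseteq> S" using l0 l1 w(1) by (auto simp: set_replicate_conv_if)
      have "list_prod G l = (w [^] Suc n \<otimes> w [^] k) \<otimes> list_prod G l1"
        unfolding l1(3) k using wc by (simp only: nat_pow_mult)
      also have "\<dots> = list_prod G ?l"
        using s S(1) l0(1) l1(1) wc
        by (subst list_prod_append list_prod_replicate l0(3) | force simp: m_assoc)+
      finally have "list_prod G l = list_prod G ?l" .
      moreover have "length ?l < length l" using l0(2) l1(2) k by simp
      ultimately show ?thesis using less.hyps[OF _ s] by metis
    qed
  qed
  have "\<exists>l. set l \<subseteq> S \<and> x = list_prod G l" if "x \<in> generate G S" for x
    using that
  proof induction
    case one
    then show ?case by (intro exI[of _ "[]"]) simp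
  next
    case (incl h)
    then show ?case using S(1) by (intro exI[of _ "[h]"]) auto
  next
    case (inv h)
    then show ?case using S(1) assms(4) by (intro exI[of _ "[inv h]"]) auto
  next
    case (eng x y)
    then obtain l l' where "set l \<subseteq> S" "x = list_prod G l" "set l' \<subseteq> S" "y = list_prod G l'" by blast
    then show ?case using S(1) by (intro exI[of _ "l @ l'"]) (simp add: list_prod_append)
  qed
  then have "generate G S \<subseteq> list_prod G ` {l. set l \<subseteq> S \<and> length l \<le> card S * n}"
    using bounded by blast
  then show ?thesis using finite_lists_length_le[OF S(2)] finite_surj by blast
qed

lemma (in group) subgroup_nat_pow_closed:
  assumes "subgroup Z G" "x \<in> Z" shows "x [^] (n::nat) \<in> Z"
  using assms by (induction n) (auto intro: subgroup.m_closed subgroup.one_closed)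

text \<open>Two of the first \<open>card Y + 1\<close> powers of \<open>w\<close> have the same representative in \<open>Y\<close>, so some \<open>w\<^bsup>d\<^esup>\<close>
  with \<open>1 \<le> d \<le> card Y\<close> lies in \<open>Z\<close>; the factorial makes the exponent independent of \<open>w\<close>.\<close>

lemma (in group) pow_mem_of_finite_index:
  assumes "subgroup X G" "subgroup Z G" "finite_index_mod G X Z"
  obtains n :: nat where "n > 0" "\<And>w. w \<in> X \<Longrightarrow> w [^] n \<in> Z"
proof -
  obtain Y where Y: "finite Y" "Y \<subseteq> carrier G" "\<forall>x\<in>X. \<exists>y\<in>Y. \<exists>z\<in>Z. x = y \<otimes> z"
    using assms(3) unfolding finite_index_mod_def by blast
  have "w [^] (fact (card Y) :: nat) \<in> Z" if w: "w \<in> X" for w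
  proof -
    have wc: "w \<in> carrier G" using w assms(1) subgroup.mem_carrier by metis
    have "\<forall>i. \<exists>y\<in>Y. \<exists>z\<in>Z. w [^] (i::nat) = y \<otimes> z"
      using Y(3) subgroup_nat_pow_closed[OF assms(1) w] by blast
    then obtain y z where yz: "\<And>i. y i \<in> Y" "\<And>i. z i \<in> Z" "\<And>i::nat. w [^] i = y i \<otimes> z i"
      by metis
    have zc: "z i \<in> carrier G" for i using yz(2) assms(2) subgroup.mem_carrier by metis
    have yc: "y i \<in> carrier G" for i using yz(1) Y(2) by blast
    have "card (y ` {..card Y}) \<le> card Y" using yz(1) Y(1) by (intro card_mono) auto
    then have "\<not> inj_on y {..card Y}" by (intro pigeonhole) simp
    then obtain i j where ij: "i < j" "j \<le> card Y" "y i = y j"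
      unfolding inj_on_def by (metis atMost_iff linorder_neqE_nat)
    define d where "d = j - i"
    have "w [^] i \<otimes> w [^] d = w [^] j" using wc ij by (simp add: nat_pow_mult d_def)
    then have "y i \<otimes> (z i \<otimes> w [^] d) = y i \<otimes> z j"
      using yz(3)[of i] yz(3)[of j] ij(3) wc zc yc by (simp add: m_assoc)
    then have "z i \<otimes> w [^] d = z j" using wc zc yc by simp
    then have "w [^] d = inv z i \<otimes> z j" using wc zc by (metis inv_mult_cancel_left(1) nat_pow_closed)
    then have "w [^] d \<in> Z" using yz(2) assms(2) by (simp add: subgroup.m_closed subgroup.m_inv_closed)
    moreover have "d dvd fact (card Y)" using ij by (intro dvd_fact) (auto simp: d_def)
    ultimately show ?thesis
      using wc subgroup_nat_pow_closed[OF assms(2)] by (metis dvdE nat_pow_pow)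
  qed
  then show ?thesis by (intro that[of "fact (card Y)"]) auto
qed

text \<open>A commutator \<open>[x, y]\<close> depends only on \<open>x\<close> modulo \<open>Z\<close> and \<open>y\<close> modulo \<open>N\<close>, so there are only
  finitely many, and Schur's trick bounds the length of the products of them.\<close>

lemma (in group) finite_commutator_subgroup:
  assumes X: "X \<lhd> G" and N: "N \<lhd> G" and Z: "subgroup Z G" "Z \<subseteq> X"
    and central: "\<And>z g. z \<in> Z \<Longrightarrow> g \<in> carrier G \<Longrightarrow> z \<otimes> g = g \<otimes> z"
    and NX: "\<And>t x. t \<in> N \<Longrightarrow> x \<in> X \<Longrightarrow> t \<otimes> x = x \<otimes> t"
    and fin: "finite_index_mod G X Z" "finite_index_mod G (carrier G) N"
  shows "finite (commutator_subgroup G X (carrier G))"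
proof -
  interpret X: normal X G by fact
  interpret N: normal N G by fact
  interpret Z: subgroup Z G by fact
  define S where "S = {commutator G x y | x y. x \<in> X \<and> y \<in> carrier G}"
  have S: "S \<subseteq> carrier G" unfolding S_def by auto
  have SX: "S \<subseteq> X" unfolding S_def using commutator_mem_normal[OF X] by blast
  obtain Y1 where Y1: "finite Y1" "Y1 \<subseteq> carrier G" "\<forall>x\<in>X. \<exists>y\<in>Y1. \<exists>z\<in>Z. x = y \<otimes> z"
    using fin(1) unfolding finite_index_mod_def by blast
  obtain Y2 where Y2: "finite Y2" "Y2 \<subseteq> carrier G" "\<forall>x\<in>carrier G. \<exists>y\<in>Y2. \<exists>z\<in>N. x = y \<otimes> z"
    using fin(2) unfolding finite_index_mod_def by blast
  have "S \<subseteq> (\<lambda>(a, b). commutator G a b) ` (Y1 \<times> Y2)"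
  proof
    fix s assume "s \<in> S"
    then obtain x y where s: "s = commutator G x y" "x \<in> X" "y \<in> carrier G" unfolding S_def by blast
    obtain a z where az: "a \<in> Y1" "z \<in> Z" "x = a \<otimes> z" using Y1(3) s(2) by blast
    obtain b t where bt: "b \<in> Y2" "t \<in> N" "y = b \<otimes> t" using Y2(3) s(3) by blast
    have c: "a \<in> carrier G" "b \<in> carrier G" using az bt Y1 Y2 by auto
    have "a = x \<otimes> inv z" using az c by (simp add: m_assoc)
    then have aX: "a \<in> X" using s(2) az(2) Z(2) by auto
    have "inv b \<otimes> a \<otimes> b \<in> X" using X.inv_op_closed1 aX c by simp
    then have "s = commutator G a b"
      unfolding s(1) az(3) bt(3) using c az bt central NX by (intro commutator_perturb) auto
    then show "s \<in> (\<lambda>(a, b). commutator G a b) ` (Y1 \<times> Y2)" using az bt by auto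
  qed
  then have finS: "finite S" using Y1(1) Y2(1) finite_subset by blast
  have conj: "g \<otimes> s \<otimes> inv g \<in> S" if g: "g \<in> carrier G" and "s \<in> S" for g s
  proof -
    obtain x y where s: "s = commutator G x y" "x \<in> X" "y \<in> carrier G"
      using \<open>s \<in> S\<close> unfolding S_def by blast
    then have "g \<otimes> s \<otimes> inv g = commutator G (g \<otimes> x \<otimes> inv g) (g \<otimes> y \<otimes> inv g)"
      using g by (simp add: conj_commutator)
    then show ?thesis unfolding S_def using s g X.inv_op_closed2 by blast
  qed
  have invS: "inv s \<in> S" if "s \<in> S" for s
  proof -
    obtain x y where s: "s = commutator G x y" "x \<in> X" "y \<in> carrier G" 
      using \<open>s \<in> S\<close> unfolding S_def by blast
    then have "commutator G (inv x) y \<in> S" unfolding S_def by blast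
    then have "inv x \<otimes> commutator G (inv x) y \<otimes> inv (inv x) \<in> S" using s by (intro conj) auto
    moreover have "inv x \<otimes> commutator G (inv x) y \<otimes> inv (inv x) = inv s"
      using s by (simp add: commutator_def inv_mult_group m_assoc)
    ultimately show ?thesis by simp
  qed
  obtain n :: nat where n: "n > 0" "\<And>w. w \<in> X \<Longrightarrow> w [^] n \<in> Z"
    using pow_mem_of_finite_index[OF X.subgroup_axioms Z(1) fin(1)] by blast
  obtain m where m: "n = Suc m" using n(1) by (cases n) auto
  have "\<exists>l. set l \<subseteq> S \<and> length l \<le> n \<and> w [^] Suc n = list_prod G l" if wS: "w \<in> S" for w
  proof -
    obtain a b where w: "w = commutator G a b" "a \<in> X" "b \<in> carrier G" using wS unfolding S_def by blast
    define g where "g = inv (a \<otimes> a) \<otimes> (inv b \<otimes> a \<otimes> b)"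
    have g: "g \<in> carrier G" using w by (simp add: g_def)
    have "w [^] n \<in> Z" using n(2) wS SX by blast
    then have "w [^] Suc n = (g \<otimes> w \<otimes> inv g) [^] m \<otimes> commutator G (a \<otimes> a) b"
      unfolding w(1) m using w central by (intro commutator_pow_shorten g_def) auto
    also have "\<dots> = list_prod G (replicate m (g \<otimes> w \<otimes> inv g) @ [commutator G (a \<otimes> a) b])"
      using g w by (subst list_prod_append) (auto simp: list_prod_replicate set_replicate_conv_if)
    finally have "w [^] Suc n = \<dots>" .
    moreover have "commutator G (a \<otimes> a) b \<in> S" unfolding S_def using w by blast
    moreover have "g \<otimes> w \<otimes> inv g \<in> S" using conj g wS by blast
    ultimately show ?thesis
      by (intro exI[of _ "replicate m (g \<otimes> w \<otimes> inv g) @ [commutator G (a \<otimes> a) b]"])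
        (auto simp: m set_replicate_conv_if)
  qed
  then show ?thesis unfolding commutator_subgroup_def S_def[symmetric]
    by (intro finite_generate_if_powers_shorten[OF S finS conj invS])
qed

text \<open>Baer's extension of Schur's theorem.  In the step from \<open>c\<close> to \<open>c + 1\<close>, modulo \<open>[N, \<^bsub>c+1\<^esub> G]\<close> the
  subgroup \<open>[N, \<^sub>c G]\<close> is central and \<open>N\<close> centralises \<open>\<gamma>\<^bsub>c+1\<^esub>(G)\<close>, so the preceding lemma shows that
  \<open>[\<gamma>\<^bsub>c+1\<^esub>(G), G]\<close> becomes finite.\<close>

lemma (in group) finite_index_lower_central:
  assumes N: "N \<lhd> G" and "finite_index_mod G (carrier G) N"
  shows "finite_index_mod G (lower_central G (Suc c)) (iter_commutator G N (carrier G) c)"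
proof (induction c)
  case 0
  then show ?case using assms by simp
next
  case (Suc c)
  let ?L = "iter_commutator G N (carrier G)"
  obtain Q :: "'a set monoid" and h where gh: "group_hom G Q h" and onto: "h ` carrier G = carrier Q"
    and ker: "?L (Suc c) = kernel G Q h"
    by (rule normal_is_kernel[OF iter_commutator_normal[OF N, of "Suc c"]])
  interpret h: group_hom G Q h by (rule gh)
  have img: "h ` X \<lhd> Q" if "X \<lhd> G" for X
    using normal.surj_hom_normal_subgroup[OF that gh onto] .
  note NQ = img[OF N] and LQ = img[OF iter_commutator_normal[OF N, of c]]
    and gQ = img[OF lower_central_normal[of c]]
  have sub: "lower_central G (Suc c) \<subseteq> carrier G" using lower_central_carrier by blast
  have "h ` lower_central G (Suc (Suc c)) = commutator_subgroup Q (h ` lower_central G (Suc c)) (carrier Q)"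
    using h.image_commutator_subgroup[OF sub subset_refl] onto by simp
  also have "finite \<dots>"
  proof (rule h.H.finite_commutator_subgroup[OF gQ NQ normal_imp_subgroup[OF LQ]])
    show "h ` ?L c \<subseteq> h ` lower_central G (Suc c)"
      using iter_commutator_le_lower_central[OF N] by blast
    show "finite_index_mod Q (h ` lower_central G (Suc c)) (h ` ?L c)"
      using Suc iter_commutator_carrier[OF N] by (intro h.finite_index_mod_image) auto
    show "finite_index_mod Q (carrier Q) (h ` N)"
      using h.finite_index_mod_image[OF assms(2)] onto N normal_imp_subgroup subgroup.subset by metis
    show "z \<otimes>\<^bsub>Q\<^esub> g = g \<otimes>\<^bsub>Q\<^esub> z" if "z \<in> h ` ?L c" "g \<in> carrier Q" for z g
    proof -
      obtain z' g' where z': "z' \<in> ?L c" "z = h z'" "g' \<in> carrier G" "g = h g'"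
        using \<open>z \<in> h ` ?L c\<close> \<open>g \<in> carrier Q\<close> onto by blast
      have "commutator G z' g' \<in> kernel G Q h"
        using z' unfolding ker[symmetric] by (simp add: commutator_mem)
      then show ?thesis using z' iter_commutator_carrier[OF N] h.commutator_kernel_iff by simp
    qed
    show "t \<otimes>\<^bsub>Q\<^esub> x = x \<otimes>\<^bsub>Q\<^esub> t" if "t \<in> h ` N" "x \<in> h ` lower_central G (Suc c)" for t x
    proof -
      obtain t' x' where t': "t' \<in> N" "t = h t'" "x' \<in> lower_central G (Suc c)" "x = h x'"
        using \<open>t \<in> h ` N\<close> \<open>x \<in> _\<close> by blast
      have "commutator G t' x' \<in> kernel G Q h"
        unfolding ker[symmetric] using N t' by (intro commutator_lower_central)
      moreover have "t' \<in> carrier G" using N t'(1) normal_imp_subgroup subgroup.mem_carrier by metis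
      ultimately show ?thesis
        using t' lower_central_carrier h.commutator_kernel_iff by metis
    qed
  qed
  finally have "finite (h ` lower_central G (Suc (Suc c)))" .
  then show ?case unfolding ker
    using lower_central_carrier by (intro h.finite_index_mod_kernel) blast
qed

lemma finite_Baer_quotient:
  fixes F :: "'f monoid"
  assumes "group_hom F G \<nu>" "finite (carrier G)"
  shows "finite (carrier (Baer_quotient c F (kernel F G \<nu>)))"
proof -
  interpret \<nu>: group_hom F G \<nu> by fact
  let ?N = "kernel F G \<nu>" and ?L = "iter_commutator F (kernel F G \<nu>) (carrier F) c"
  interpret L: normal ?L F by (intro \<nu>.G.iter_commutator_normal \<nu>.normal_kernel)
  have "finite_index_mod F (carrier F) ?N"
    by (rule \<nu>.finite_index_mod_kernel) (auto intro: finite_subset[OF _ assms(2)])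
  then have "finite_index_mod F (lower_central F (Suc c)) ?L"
    by (rule \<nu>.G.finite_index_lower_central[OF \<nu>.normal_kernel])
  then obtain Y where Y: "finite Y" "Y \<subseteq> carrier F"
    "\<forall>x\<in>lower_central F (Suc c). \<exists>y\<in>Y. \<exists>z\<in>?L. x = y \<otimes>\<^bsub>F\<^esub> z"
    unfolding finite_index_mod_def by blast
  have "?L #>\<^bsub>F\<^esub> x \<in> (\<lambda>y. ?L #>\<^bsub>F\<^esub> y) ` Y" if "x \<in> lower_central F (Suc c)" for x
  proof -
    obtain y z where y: "y \<in> Y" "z \<in> ?L" "x = y \<otimes>\<^bsub>F\<^esub> z" using Y(3) \<open>x \<in> _\<close> by blast
    have yc: "y \<in> carrier F" using y Y by auto
    have "x = (y \<otimes>\<^bsub>F\<^esub> z \<otimes>\<^bsub>F\<^esub> inv\<^bsub>F\<^esub> y) \<otimes>\<^bsub>F\<^esub> y" using y yc by (simp add: \<nu>.G.m_assoc)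
    moreover have "y \<otimes>\<^bsub>F\<^esub> z \<otimes>\<^bsub>F\<^esub> inv\<^bsub>F\<^esub> y \<in> ?L" using y yc L.inv_op_closed2 by simp
    ultimately have "x \<in> ?L #>\<^bsub>F\<^esub> y" unfolding r_coset_def by blast
    then have "?L #>\<^bsub>F\<^esub> y = ?L #>\<^bsub>F\<^esub> x" using yc L.subgroup_axioms by (rule \<nu>.G.repr_independence)
    then show ?thesis using y by blast
  qed
  then have "carrier (Baer_quotient c F ?N) \<subseteq> (\<lambda>y. ?L #>\<^bsub>F\<^esub> y) ` Y"
    by (auto simp: Baer_quotient_def carrier_FactGroup)
  then show ?thesis using Y(1) finite_surj by blast
qed

section \<open>Quotients of finite abelian groups embed\<close>

lemma (in group) mem_subgroup_if_coprime_powers: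
  assumes K: "subgroup K G" and x: "x \<in> carrier G"
    and p: "prime p" and "x [^] (p::nat) \<in> K" "x [^] (a::int) \<in> K" "\<not> int p dvd a"
  shows "x \<in> K"
proof -
  have "coprime (int p) a" using p assms(6) by (simp add: prime_imp_coprime)
  then obtain u v where uv: "u * int p + v * a = 1" using bezout_int[of "int p" a] by auto
  have "x = x [^] (u * int p + v * a)" using x by (simp add: uv)
  also have "\<dots> = (x [^] int p) [^] u \<otimes> (x [^] a) [^] v"
    using x by (simp add: int_pow_mult int_pow_pow mult.commute)
  also have "\<dots> \<in> K"
    using assms(4,5) by (intro subgroup.m_closed[OF K]; intro subgroup_int_pow_closed[OF K, of "x [^] _"])
      (simp_all only: int_pow_int)
  finally show ?thesis .
qed

lemma (in comm_group) powers_subgroup: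
  fixes j :: nat
  shows "subgroup ((\<lambda>x. x [^] j) ` carrier G) G"
proof -
  have "group_hom G G (\<lambda>x. x [^] j)"
    by unfold_locales (auto simp: hom_def nat_pow_distrib)
  then show ?thesis using group_hom.img_is_subgroup by blast
qed

text \<open>Write \<open>n = m\<^bsup>p^k\<^esup>\<close> with \<open>k\<close> as large as possible.  Then \<open>m\<close> generates a direct factor \<open>D\<close> of \<open>G\<close>,
  and the endomorphism that raises \<open>D\<close> to the power \<open>p\<close> and fixes a complement has kernel \<open>\<langle>n\<rangle>\<close>.
  The complement is a subgroup \<open>C\<close> that is maximal among those that avoid \<open>n\<close> and contain all
  \<open>p\<^bsup>k+1\<^esup>\<close>-th powers; by the choice of \<open>k\<close> these powers do avoid \<open>n\<close>.  That \<open>C\<close> contains them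
  reduces \<open>C D = G\<close> to the claim that \<open>C D\<close> is closed under taking \<open>p\<close>-th roots.\<close>

lemma (in comm_group) endomorphism_with_prime_kernel:
  assumes fin: "finite (carrier G)" and p: "prime (p::nat)"
    and n: "n \<in> carrier G" "n \<noteq> \<one>" "n [^] p = \<one>"
  obtains f where "f \<in> hom G G" "kernel G G f = generate G {n}"
proof -
  define P where "P j = (\<lambda>x. x [^] (p ^ j)) ` carrier G" for j
  have "n \<notin> P (order G)"
  proof
    assume "n \<in> P (order G)"
    then obtain y where y: "y \<in> carrier G" "n = y [^] (p ^ order G)" by (auto simp: P_def)
    then have "y [^] (p ^ Suc (order G)) = \<one>"
      using n(3) by (simp add: nat_pow_pow mult.commute)
    then have "ord y dvd p ^ Suc (order G)" using y(1) pow_eq_id by blast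
    then obtain i where i: "ord y = p ^ i" using divides_primepow_nat[OF p] by blast
    have "i < p ^ i" using power_gt_expt[of p i] prime_gt_1_nat[OF p] by simp
    also have "\<dots> \<le> order G" using ord_le_group_order[OF fin y(1)] by (simp add: i)
    finally have "ord y dvd p ^ order G" unfolding i by (intro le_imp_power_dvd) simp
    then show False using y n(2) pow_eq_id by blast
  qed
  moreover have "n \<in> P 0" using n(1) by (force simp: P_def)
  ultimately obtain k where k: "n \<in> P k" "n \<notin> P (Suc k)"
    using dec_induct[of 0 "order G" "\<lambda>k. n \<in> P k"] by auto
  obtain m where m: "m \<in> carrier G" "n = m [^] (p ^ k)" using k(1) by (auto simp: P_def)
  have pk: "p ^ Suc k = p ^ k * p" by simp
  define fam where "fam = {C. subgroup C G \<and> P (Suc k) \<subseteq> C \<and> n \<notin> C}"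
  have "fam \<subseteq> Pow (carrier G)" by (auto simp: fam_def dest: subgroup.subset)
  then have "finite fam" using fin finite_subset by blast
  moreover have "P (Suc k) \<in> fam"
    using k(2) powers_subgroup[of "p ^ Suc k"] by (simp add: fam_def P_def)
  ultimately obtain C where C: "C \<in> fam" "\<forall>C'\<in>fam. C \<subseteq> C' \<longrightarrow> C = C'"
    using finite_has_maximal[of fam] by blast
  have sC: "subgroup C G" and PC: "P (Suc k) \<subseteq> C" and nC: "n \<notin> C" using C(1) by (auto simp: fam_def)
  interpret C: subgroup C G by (rule sC)
  define D where "D = generate G {m}"
  have D: "D = {m [^] (j::int) | j. j \<in> UNIV}" using generate_pow[OF m(1)] by (simp add: D_def)
  have sD: "subgroup D G" unfolding D_def using m(1) by (intro generate_is_subgroup) simp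
  interpret D: subgroup D G by (rule sD)
  define H where "H = C <#> D"
  have sH: "subgroup H G" unfolding H_def using sC sD by (rule mult_subgroups)
  interpret H: subgroup H G by (rule sH)
  have CH: "C \<subseteq> H" and DH: "D \<subseteq> H"
  proof -
    have "c \<otimes> d \<in> H" if "c \<in> C" "d \<in> D" for c d
      unfolding H_def set_mult_def using that by blast
    then show "C \<subseteq> H" "D \<subseteq> H"
      using C.one_closed D.one_closed C.subset D.subset by (metis r_one l_one subset_iff)+
  qed
  have nD: "n \<in> D" unfolding D m(2) using int_pow_int[of G m "p ^ k"] by (metis (mono_tags) UNIV_I mem_Collect_eq)
  have root: "x \<in> H" if x: "x \<in> carrier G" and xp: "x [^] p \<in> H" for x
  proof (rule ccontr)
    assume xH: "x \<notin> H"
    obtain c a where ca: "c \<in> C" "x [^] p = c \<otimes> m [^] (a::int)"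
      using xp unfolding H_def set_mult_def D by blast
    have cc: "c \<in> carrier G" using ca by simp
    show False
    proof (cases "int p dvd a")
      \<comment> \<open>In this case the \<open>p\<^bsup>k+1\<^esup>\<close>-th power of \<open>x\<close>, which lies in \<open>C\<close>, brings \<open>n\<^bsup>a\<^esup>\<close> into \<open>C\<close>.\<close>
      case False
      have "x [^] (p ^ Suc k) = (x [^] p) [^] (p ^ k)" using x by (simp add: nat_pow_pow mult.commute)
      also have "\<dots> = c [^] (p ^ k) \<otimes> (m [^] a) [^] (p ^ k)"
        using cc m(1) by (simp add: ca(2) nat_pow_distrib)
      also have "(m [^] a) [^] (p ^ k) = n [^] a"
        using m by (simp add: int_pow_pow mult.commute flip: int_pow_int)
      finally have eq: "x [^] (p ^ Suc k) = c [^] (p ^ k) \<otimes> n [^] a" .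
      have "x [^] (p ^ Suc k) \<in> C" using PC x by (auto simp: P_def)
      moreover have "c [^] (p ^ k) \<in> C" using ca(1) sC subgroup_int_pow_closed by (metis int_pow_int)
      moreover have "n [^] a = inv (c [^] (p ^ k)) \<otimes> x [^] (p ^ Suc k)" using eq cc n(1) by simp
      ultimately have "n [^] a \<in> C" by (simp add: C.m_closed C.m_inv_closed del: power_Suc)
      then have "n \<in> C"
        using n False p C.one_closed by (intro mem_subgroup_if_coprime_powers[OF sC, of n p a]) auto
      then show False using nC by simp
    next
      case True
      then obtain b where b: "a = int p * b" by blast
      define y where "y = x \<otimes> m [^] (- b)"
      have yc: "y \<in> carrier G" using x m(1) by (simp add: y_def)
      have mb: "m [^] (- b) \<in> H" using DH unfolding D by blast
      have "y [^] p = x [^] p \<otimes> (m [^] (- b)) [^] p" using x m(1) by (simp add: y_def nat_pow_distrib)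
      also have "(m [^] (- b)) [^] p = m [^] (- a)"
        using m(1) by (simp add: b int_pow_pow mult.commute flip: int_pow_int)
      also have "x [^] p \<otimes> m [^] (- a) = c"
        using cc m(1) by (simp add: ca(2) m_assoc int_pow_neg)
      finally have yp: "y [^] p = c" .
      have yH: "y \<notin> H"
      proof
        assume "y \<in> H"
        then have "y \<otimes> inv (m [^] (- b)) \<in> H" using mb by (simp add: H.m_closed H.m_inv_closed)
        then show False using xH x m(1) by (simp add: y_def m_assoc)
      qed
      \<comment> \<open>Now \<open>y\<close> is outside \<open>C\<close> with \<open>y\<^bsup>p\<^esup> \<in> C\<close>, and maximality puts \<open>n\<close> into \<open>C \<langle>y\<rangle>\<close>.\<close>
      define C' where "C' = C <#> generate G {y}"
      have gy: "generate G {y} = {y [^] (j::int) | j. j \<in> UNIV}" using generate_pow[OF yc] by simp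
      have sC': "subgroup C' G"
        unfolding C'_def using yc by (intro mult_subgroups sC generate_is_subgroup) simp
      have CC': "C \<subseteq> C'"
      proof
        fix z assume "z \<in> C"
        then have "z \<otimes> y [^] (0::int) \<in> C'" unfolding C'_def set_mult_def gy by blast
        then show "z \<in> C'" using \<open>z \<in> C\<close> by simp
      qed
      have "\<one> \<otimes> y [^] (1::int) \<in> C'" unfolding C'_def set_mult_def gy using C.one_closed by blast
      then have "y \<in> C'" using yc by simp
      then have "C \<noteq> C'" using yH CH by blast
      then have "n \<in> C'" using C(2) CC' sC' PC unfolding fam_def by blast
      then obtain c' j where cj: "c' \<in> C" "n = c' \<otimes> y [^] (j::int)"
        unfolding C'_def set_mult_def gy by blast
      have c'c: "c' \<in> carrier G" using cj by simp
      show False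
      proof (cases "int p dvd j")
        case True
        then obtain i where "j = int p * i" by blast
        then have "y [^] j = c [^] i" using yc by (simp add: yp[symmetric] int_pow_pow flip: int_pow_int)
        then have "y [^] j \<in> C" using subgroup_int_pow_closed[OF sC ca(1)] by simp
        then show False using cj nC C.m_closed by simp
      next
        case False
        have "y [^] j = inv c' \<otimes> n" using cj c'c yc by simp
        then have "y [^] j \<in> H" using cj(1) CH nD DH by (simp add: H.m_closed H.m_inv_closed subset_iff)
        moreover have "y [^] p \<in> H" using yp ca(1) CH by blast
        ultimately show False
          using mem_subgroup_if_coprime_powers[OF sH yc p _ _ False] yH by blast
      qed
    qed
  qed
  have carrierH: "C <#> D = carrier G"
  proof -
    have "x [^] (p ^ i) \<in> H \<Longrightarrow> x \<in> H" if "x \<in> carrier G" for x i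
    proof (induction i)
      case (Suc i)
      have "(x [^] (p ^ i)) [^] p \<in> H" using Suc.prems that by (simp add: nat_pow_pow mult.commute)
      then show ?case using root[of "x [^] (p ^ i)"] that Suc.IH by simp
    qed (use that in simp)
    moreover have "x [^] (p ^ Suc k) \<in> H" if "x \<in> carrier G" for x
      using PC CH that by (auto simp: P_def)
    ultimately have "carrier G \<subseteq> H" by blast
    then show ?thesis using H.subset unfolding H_def by blast
  qed
  have ordm: "ord m = p ^ Suc k"
  proof -
    have "m [^] (p ^ Suc k) = \<one>" using m n(3) by (simp add: nat_pow_pow mult.commute)
    then have "ord m dvd p ^ Suc k" using m(1) pow_eq_id by blast
    then obtain i where i: "ord m = p ^ i" "i \<le> Suc k" using divides_primepow_nat[OF p] by blast
    have "\<not> i \<le> k"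
    proof
      assume "i \<le> k"
      then have "m [^] (p ^ k) = \<one>" using m(1) i(1) pow_eq_id le_imp_power_dvd by metis
      then show False using m(2) n(2) by simp
    qed
    then have "i = Suc k" using i(2) by simp
    then show ?thesis using i(1) by simp
  qed
  have disj: "C \<inter> D = {\<one>}"
  proof -
    have "x = \<one>" if "x \<in> C" "x \<in> D" for x
    proof (rule ccontr)
      assume x1: "x \<noteq> \<one>"
      obtain j :: int where j: "x = m [^] j" using \<open>x \<in> D\<close> unfolding D by blast
      have "j \<noteq> 0" using x1 j by auto
      then obtain i where i: "j = int p ^ multiplicity (int p) j * i" "\<not> int p dvd i"
        using multiplicity_decompose'[of j "int p"] p by (metis not_prime_unit prime_nat_int_transfer)
      define e where "e = multiplicity (int p) j"
      have "e \<le> k"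
      proof (rule ccontr)
        assume "\<not> e \<le> k"
        then have "int p ^ Suc k dvd j" using i(1) le_imp_power_dvd[of "Suc k" e "int p"]
          by (metis dvd_mult2 e_def not_less_eq_eq)
        then have "m [^] j = \<one>" using int_pow_eq_id[OF m(1)] ordm by simp
        then show False using j x1 by simp
      qed
      have "j * int (p ^ (k - e)) = int p ^ (e + (k - e)) * i"
        using i(1) by (simp add: e_def power_add mult_ac)
      then have "j * int (p ^ (k - e)) = int (p ^ k) * i" using \<open>e \<le> k\<close> by simp
      then have "x [^] (p ^ (k - e)) = m [^] (int (p ^ k) * i)"
        unfolding j using int_pow_pow[OF m(1), of j "int (p ^ (k - e))"] by (simp only: int_pow_int)
      also have "\<dots> = n [^] i" using m by (simp add: int_pow_pow flip: int_pow_int)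
      finally have "n [^] i \<in> C"
        using \<open>x \<in> C\<close> sC subgroup_int_pow_closed by (metis int_pow_int)
      then show False
        using nC n p i(2) C.one_closed mem_subgroup_if_coprime_powers[OF sC n(1) p] by simp
    qed
    then show ?thesis using C.one_closed D.one_closed by blast
  qed
  obtain q where q: "q \<in> hom G (G\<lparr>carrier := D\<rparr>)" "\<And>c d. c \<in> C \<Longrightarrow> d \<in> D \<Longrightarrow> q (c \<otimes> d) = d"
    using complement_projection[OF subgroup_imp_normal[OF sC] sD carrierH disj] by blast
  have qD: "q x \<in> D" if "x \<in> carrier G" for x using q(1) that by (auto simp: hom_def)
  have qm: "q (x \<otimes> y) = q x \<otimes> q y" if "x \<in> carrier G" "y \<in> carrier G" for x y
    using hom_mult[OF q(1) that] by simp
  define f where "f x = x \<otimes> q x [^] (p - 1)" for x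
  have f: "f \<in> hom G G"
    using qD by (intro homI) (auto simp: f_def qm nat_pow_distrib m_ac)
  have p1: "p = Suc (p - 1)" using prime_gt_0_nat[OF p] by simp
  have fcd: "f (c \<otimes> d) = c \<otimes> d [^] p" if cd: "c \<in> C" "d \<in> D" for c d
  proof -
    have "d [^] p = d \<otimes> d [^] (p - 1)" using cd p1 nat_pow_Suc2[of d "p - 1"] by simp
    then show ?thesis using cd by (simp add: f_def q(2) m_assoc)
  qed
  have ghf: "group_hom G G f" using f by unfold_locales
  have "kernel G G f \<subseteq> generate G {n}"
  proof
    fix x assume "x \<in> kernel G G f"
    then have x: "x \<in> carrier G" "f x = \<one>" by (auto simp: kernel_def)
    then obtain c d where cd: "c \<in> C" "d \<in> D" "x = c \<otimes> d"
      unfolding carrierH[symmetric] set_mult_def by blast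
    have e: "c \<otimes> d [^] p = \<one>" using x fcd cd by simp
    have dp: "d [^] p \<in> D" using cd(2) sD subgroup_int_pow_closed by (metis int_pow_int)
    have "inv (d [^] p) = c" using e cd dp by (intro inv_equality) auto
    then have "c \<in> D" using dp D.m_inv_closed by blast
    then have c1: "c = \<one>" using disj cd(1) by blast
    then have d1: "d [^] p = \<one>" using e cd dp by simp
    obtain j :: int where j: "d = m [^] j" using cd(2) unfolding D by blast
    have "m [^] (j * int p) = \<one>" using d1 m(1) by (simp add: j int_pow_pow flip: int_pow_int)
    then have "int p ^ Suc k dvd j * int p" using int_pow_eq_id[OF m(1)] ordm by simp
    then have "int p ^ k dvd j" using prime_gt_0_nat[OF p] by simp
    then obtain i where "j = int p ^ k * i" by blast
    then have "x = n [^] i" using cd c1 m j by (simp add: int_pow_pow flip: int_pow_int)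
    then show "x \<in> generate G {n}" using generate_pow[OF n(1)] by blast
  qed
  moreover have "n \<in> kernel G G f"
    using fcd[OF C.one_closed nD] n by (simp add: kernel_def)
  then have "generate G {n} \<subseteq> kernel G G f"
    using group_hom.subgroup_kernel[OF ghf] by (intro generate_subgroup_incl) auto
  ultimately show ?thesis using that[OF f] by blast
qed

text \<open>An endomorphism \<open>f\<close> that kills a subgroup of prime order in \<open>N\<close> makes the image of \<open>N\<close> smaller; compose
  it with an endomorphism that has kernel \<open>f(N)\<close>.\<close>

lemma (in comm_group) endomorphism_with_kernel:
  assumes fin: "finite (carrier G)" and N: "subgroup N G"
  shows "\<exists>f\<in>hom G G. kernel G G f = N"
  using N
proof (induction "card N" arbitrary: N rule: less_induct)
  case less
  interpret N: subgroup N G by (rule less.prems)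
  show ?case
  proof (cases "N = {\<one>}")
    case True
    then show ?thesis by (intro bexI[of _ id]) (auto simp: kernel_def hom_def)
  next
    case False
    then obtain n0 where n0: "n0 \<in> N" "n0 \<noteq> \<one>" using N.one_closed by blast
    have n0c: "n0 \<in> carrier G" using n0 by simp
    have "ord n0 \<noteq> 1" using ord_eq_1[OF n0c] n0(2) by simp
    then obtain p where p: "prime p" "p dvd ord n0" using prime_factor_nat by blast
    then obtain s where s: "ord n0 = p * s" by blast
    define n where "n = n0 [^] s"
    have "ord n0 > 0" using ord_ge_1[OF fin n0c] by simp
    then have "s > 0" "s < ord n0" using s prime_gt_1_nat[OF p(1)] by auto
    then have "\<not> ord n0 dvd s" using dvd_imp_le by fastforce
    then have n: "n \<in> carrier G" "n \<noteq> \<one>" "n [^] p = \<one>"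
      using n0c pow_eq_id[OF n0c, of s] pow_eq_id[OF n0c, of "ord n0"] s
      by (auto simp: n_def nat_pow_pow mult.commute)
    have nN: "n \<in> N" unfolding n_def using n0(1) less.prems subgroup_int_pow_closed by (metis int_pow_int)
    obtain f where f: "f \<in> hom G G" "kernel G G f = generate G {n}"
      by (rule endomorphism_with_prime_kernel[OF fin p(1) n])
    interpret f: group_hom G G f using f(1) by unfold_locales
    have kerN: "kernel G G f \<subseteq> N" unfolding f(2) using nN less.prems by (intro generate_subgroup_incl) auto
    have finN: "finite N" using fin N.subset finite_subset by blast
    have "n \<in> kernel G G f" unfolding f(2) by (rule generate.incl) simp
    then have "f n = f \<one>" by (simp add: kernel_def)
    then have "\<not> inj_on f N" using n(2) nN N.one_closed unfolding inj_on_def by metis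
    then have "card (f ` N) < card N"
      using card_image_le[OF finN] eq_card_imp_inj_on[OF finN] by (metis le_neq_implies_less)
    then obtain g where g: "g \<in> hom G G" "kernel G G g = f ` N"
      using less.hyps[of "f ` N"] f.subgroup_img_is_subgroup[OF less.prems] by blast
    have "x \<in> N" if x: "x \<in> carrier G" "f x \<in> f ` N" for x
    proof -
      obtain y where y: "y \<in> N" "f x = f y" using x(2) by blast
      then have "x \<otimes> inv y \<in> N" using kerN f.kernel_diff_iff[OF x(1)] by auto
      then have "x \<otimes> inv y \<otimes> y \<in> N" using y(1) by (rule N.m_closed)
      then show ?thesis using x(1) y(1) by (simp add: m_assoc)
    qed
    moreover have "g (f x) = \<one> \<longleftrightarrow> f x \<in> f ` N" if "x \<in> carrier G" for x
      using g(2) f.hom_closed[OF that] unfolding kernel_def by blast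
    ultimately have "kernel G G (g \<circ> f) = N" using N.subset by (auto simp: kernel_def)
    moreover have "g \<circ> f \<in> hom G G" using f(1) g(1) by (auto simp: hom_def)
    ultimately show ?thesis by blast
  qed
qed

text \<open>If \<open>f\<close> is an endomorphism with the same kernel as \<open>\<phi>\<close>, then \<open>Q \<cong> G / ker f \<cong> f(G)\<close>.\<close>

lemma (in comm_group) epimorphic_image_embeds:
  assumes fin: "finite (carrier G)" and Q: "group Q" and \<phi>: "\<phi> \<in> epi G Q"
  shows "\<exists>H. subgroup H G \<and> G\<lparr>carrier := H\<rparr> \<cong> Q"
proof -
  interpret \<phi>: group_hom G Q \<phi>
    using \<phi> Q by (simp add: group_hom_def group_hom_axioms_def epi_def is_group)
  obtain f where f: "f \<in> hom G G" "kernel G G f = kernel G Q \<phi>"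
    using endomorphism_with_kernel[OF fin \<phi>.subgroup_kernel] by blast
  interpret f: group_hom G G f using f(1) by unfold_locales
  let ?H = "f ` carrier G"
  have H: "subgroup ?H G" by (rule f.img_is_subgroup)
  interpret f': group_hom G "G\<lparr>carrier := ?H\<rparr>" f
    using f(1) subgroup_imp_group[OF H]
    by (auto simp: group_hom_def group_hom_axioms_def hom_def is_group)
  have "G Mod kernel G (G\<lparr>carrier := ?H\<rparr>) f \<cong> G\<lparr>carrier := ?H\<rparr>" by (rule f'.FactGroup_iso) simp
  moreover have "kernel G (G\<lparr>carrier := ?H\<rparr>) f = kernel G Q \<phi>" using f(2) by (simp add: kernel_def)
  ultimately have 1: "G Mod kernel G Q \<phi> \<cong> G\<lparr>carrier := ?H\<rparr>" by simp
  have 2: "G Mod kernel G Q \<phi> \<cong> Q" using \<phi> by (intro \<phi>.FactGroup_iso) (simp add: epi_def)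
  have "group (G Mod kernel G Q \<phi>)" using \<phi>.normal_kernel normal.factorgroup_is_group by blast
  then have "G\<lparr>carrier := ?H\<rparr> \<cong> Q" using 1 2 group.iso_sym iso_trans by blast
  then show ?thesis using H by blast
qed

section \<open>Maps of Baer quotients\<close>

lemma iter_commutator_normal_Baer:
  fixes F :: "'f monoid"
  assumes "group F" "N \<lhd> F"
  shows "iter_commutator F N (carrier F) c \<lhd> F\<lparr>carrier := N \<inter> lower_central F (c + 1)\<rparr>"
proof -
  interpret F: group F by fact
  let ?L = "iter_commutator F N (carrier F) c" and ?S = "N \<inter> lower_central F (c + 1)"
  let ?FS = "F\<lparr>carrier := ?S\<rparr>"
  have S: "?S \<lhd> F" using assms(2) F.lower_central_normal[of c] F.normal_subgroup_intersect by simp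
  then have sS: "subgroup ?S F" by (rule normal_imp_subgroup)
  have L: "?L \<lhd> F" using assms(2) by (rule F.iter_commutator_normal)
  have "?L \<subseteq> ?S"
    using F.iter_commutator_le[OF assms(2)] F.iter_commutator_le_lower_central[OF assms(2)] by simp
  then show "?L \<lhd> ?FS" by (rule F.normal_restrict_supergroup[OF sS L])
qed

text \<open>Commutators of elements of \<open>N\<close> with elements of \<open>\<gamma>\<^bsub>c+1\<^esub>(F)\<close> lie in \<open>[N, \<^bsub>c+1\<^esub> F]\<close>.\<close>

lemma comm_group_Baer_quotient:
  fixes F :: "'f monoid"
  assumes "group F" "N \<lhd> F"
  shows "comm_group (Baer_quotient c F N)"
proof -
  interpret F: group F by fact
  let ?L = "iter_commutator F N (carrier F) c" and ?S = "N \<inter> lower_central F (c + 1)"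
  let ?FS = "F\<lparr>carrier := ?S\<rparr>"
  have S: "?S \<lhd> F" using assms(2) F.lower_central_normal[of c] F.normal_subgroup_intersect by simp
  then have sS: "subgroup ?S F" by (rule normal_imp_subgroup)
  have L: "?L \<lhd> F" using assms(2) by (rule F.iter_commutator_normal)
  interpret LS: normal ?L ?FS by (rule iter_commutator_normal_Baer[OF assms])
  have "group (Baer_quotient c F N)" unfolding Baer_quotient_def by (rule LS.factorgroup_is_group)
  then show "comm_group (Baer_quotient c F N)"
  proof (rule group.group_comm_groupI)
    fix u v assume "u \<in> carrier (Baer_quotient c F N)" "v \<in> carrier (Baer_quotient c F N)"
    then obtain x y where xy: "x \<in> ?S" "u = ?L #>\<^bsub>?FS\<^esub> x" "y \<in> ?S" "v = ?L #>\<^bsub>?FS\<^esub> y"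
      by (auto simp: Baer_quotient_def carrier_FactGroup)
    have xyc: "x \<in> carrier F" "y \<in> carrier F" using xy sS subgroup.mem_carrier by metis+
    have "commutator F x y \<in> iter_commutator F N (carrier F) (Suc c)"
      using xy by (intro F.commutator_lower_central assms(2)) auto
    then have "commutator F x y \<in> ?L" using F.iter_commutator_Suc_le[OF assms(2)] by blast
    obtain Q :: "'f set monoid" and h where gh: "group_hom F Q h" and "h ` carrier F = carrier Q"
      and ker: "?L = kernel F Q h"
      by (rule normal_is_kernel[OF L])
    interpret h: group_hom F Q h by (rule gh)
    have "h x \<otimes>\<^bsub>Q\<^esub> h y = h y \<otimes>\<^bsub>Q\<^esub> h x"
      using \<open>commutator F x y \<in> ?L\<close> xyc h.commutator_kernel_iff unfolding ker by blast
    then have "(x \<otimes>\<^bsub>F\<^esub> y) \<otimes>\<^bsub>F\<^esub> inv\<^bsub>F\<^esub> (y \<otimes>\<^bsub>F\<^esub> x) \<in> ?L"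
      unfolding ker using xyc by (subst h.kernel_diff_iff) auto
    then have "x \<otimes>\<^bsub>F\<^esub> y \<in> ?L #>\<^bsub>F\<^esub> (y \<otimes>\<^bsub>F\<^esub> x)"
      using xyc normal_imp_subgroup[OF L] subgroup.rcos_module_rev F.is_group F.m_closed by metis
    then have "?L #>\<^bsub>F\<^esub> (x \<otimes>\<^bsub>F\<^esub> y) = ?L #>\<^bsub>F\<^esub> (y \<otimes>\<^bsub>F\<^esub> x)"
      using xyc normal_imp_subgroup[OF L] F.repr_independence F.m_closed by metis
    then have "?L #>\<^bsub>?FS\<^esub> (x \<otimes>\<^bsub>?FS\<^esub> y) = ?L #>\<^bsub>?FS\<^esub> (y \<otimes>\<^bsub>?FS\<^esub> x)" by simp
    then show "u \<otimes>\<^bsub>Baer_quotient c F N\<^esub> v = v \<otimes>\<^bsub>Baer_quotient c F N\<^esub> u"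
      using xy LS.rcos_sum[of x y] LS.rcos_sum[of y x] by (simp add: Baer_quotient_def)
  qed
qed

text \<open>What is needed about the Baer quotient is only that it receives a surjective homomorphism \<open>r\<close> that identifies
  elements congruent modulo \<open>[N, \<^sub>c Y]\<close>; working with \<open>r\<close> keeps cosets out of the diagram chase.\<close>

lemma Baer_quotient_projection:
  fixes Y :: "'y monoid"
  assumes "group Y" "N \<lhd> Y"
  obtains r where "r \<in> hom (Y\<lparr>carrier := N \<inter> lower_central Y (c + 1)\<rparr>) (Baer_quotient c Y N)"
    "r ` (N \<inter> lower_central Y (c + 1)) = carrier (Baer_quotient c Y N)"
    "\<And>x y. x \<in> N \<inter> lower_central Y (c + 1) \<Longrightarrow> y \<in> N \<inter> lower_central Y (c + 1) \<Longrightarrow>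
      x \<otimes>\<^bsub>Y\<^esub> inv\<^bsub>Y\<^esub> y \<in> iter_commutator Y N (carrier Y) c \<Longrightarrow> r x = r y"
proof -
  interpret Y: group Y by fact
  let ?L = "iter_commutator Y N (carrier Y) c" and ?S = "N \<inter> lower_central Y (c + 1)"
  let ?YS = "Y\<lparr>carrier := ?S\<rparr>"
  have S: "?S \<lhd> Y" using assms(2) Y.lower_central_normal[of c] Y.normal_subgroup_intersect by simp
  interpret LS: normal ?L ?YS by (rule iter_commutator_normal_Baer[OF assms])
  have L: "subgroup ?L Y" using assms(2) Y.iter_commutator_normal normal_imp_subgroup by blast
  show ?thesis
  proof (rule that[of "\<lambda>x. ?L #>\<^bsub>?YS\<^esub> x"])
    show "(\<lambda>x. ?L #>\<^bsub>?YS\<^esub> x) \<in> hom ?YS (Baer_quotient c Y N)"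
      unfolding Baer_quotient_def by (rule LS.r_coset_hom_Mod)
    show "(\<lambda>x. ?L #>\<^bsub>?YS\<^esub> x) ` ?S = carrier (Baer_quotient c Y N)"
      by (simp add: Baer_quotient_def carrier_FactGroup)
    fix x y assume xy: "x \<in> ?S" "y \<in> ?S" "x \<otimes>\<^bsub>Y\<^esub> inv\<^bsub>Y\<^esub> y \<in> ?L"
    have "x \<in> carrier Y" "y \<in> carrier Y"
      using xy normal_imp_subgroup[OF S] subgroup.mem_carrier by metis+
    then show "?L #>\<^bsub>?YS\<^esub> x = ?L #>\<^bsub>?YS\<^esub> y"
      using xy(3) L subgroup.rcos_module_rev[OF L assms(1)] Y.repr_independence by simp metis
  qed
qed

text \<open>By the second part, the composite factors through the Baer quotient of \<open>Y\<close>.\<close>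

lemma Baer_quotient_map:
  fixes Y :: "'y monoid" and Z :: "'z monoid"
  assumes h: "group_hom Y Z h" and N: "N \<lhd> Y" and M: "M \<lhd> Z" and sub: "h ` N \<subseteq> M"
    and s: "s \<in> hom (Z\<lparr>carrier := M \<inter> lower_central Z (c + 1)\<rparr>) (Baer_quotient c Z M)"
      "\<And>x y. x \<in> M \<inter> lower_central Z (c + 1) \<Longrightarrow> y \<in> M \<inter> lower_central Z (c + 1) \<Longrightarrow>
        x \<otimes>\<^bsub>Z\<^esub> inv\<^bsub>Z\<^esub> y \<in> iter_commutator Z M (carrier Z) c \<Longrightarrow> s x = s y"
  shows "s \<circ> h \<in> hom (Y\<lparr>carrier := N \<inter> lower_central Y (c + 1)\<rparr>) (Baer_quotient c Z M)"
    and "iter_commutator Y N (carrier Y) c \<subseteq>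
      kernel (Y\<lparr>carrier := N \<inter> lower_central Y (c + 1)\<rparr>) (Baer_quotient c Z M) (s \<circ> h)"
proof -
  interpret h: group_hom Y Z h by fact
  let ?SZ = "M \<inter> lower_central Z (c + 1)" and ?SY = "N \<inter> lower_central Y (c + 1)"
  have SZ: "h x \<in> ?SZ" if "x \<in> ?SY" for x
    using that sub h.hom_lower_central[of x c] by auto
  have SYc: "x \<in> carrier Y" if "x \<in> ?SY" for x using that h.G.lower_central_carrier[of x c] by simp
  have "?SZ \<lhd> Z" using M h.H.lower_central_normal[of c] h.H.normal_subgroup_intersect by simp
  then have sSZ: "subgroup ?SZ Z" by (rule normal_imp_subgroup)
  have gZ: "group (Z\<lparr>carrier := ?SZ\<rparr>)" using sSZ h.H.subgroup_imp_group by blast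
  have gB: "group (Baer_quotient c Z M)"
    using comm_group_Baer_quotient[OF _ M] h.H.is_group comm_group_def by blast
  show "s \<circ> h \<in> hom (Y\<lparr>carrier := ?SY\<rparr>) (Baer_quotient c Z M)"
  proof (rule homI)
    fix x y assume xy: "x \<in> carrier (Y\<lparr>carrier := ?SY\<rparr>)"
    show "(s \<circ> h) x \<in> carrier (Baer_quotient c Z M)"
      using hom_in_carrier[OF s(1)] SZ xy by simp
    assume y: "y \<in> carrier (Y\<lparr>carrier := ?SY\<rparr>)"
    show "(s \<circ> h) (x \<otimes>\<^bsub>Y\<lparr>carrier := ?SY\<rparr>\<^esub> y)
        = (s \<circ> h) x \<otimes>\<^bsub>Baer_quotient c Z M\<^esub> (s \<circ> h) y"
      using hom_mult[OF s(1), of "h x" "h y"] SZ SYc xy y by simp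
  qed
  show "iter_commutator Y N (carrier Y) c \<subseteq> kernel (Y\<lparr>carrier := ?SY\<rparr>) (Baer_quotient c Z M) (s \<circ> h)"
  proof
    fix x assume x: "x \<in> iter_commutator Y N (carrier Y) c"
    have "x \<in> lower_central Y (Suc c)" using x h.G.iter_commutator_le_lower_central[OF N] by blast
    then have xS: "x \<in> ?SY" using x h.G.iter_commutator_le[OF N] by auto
    have "h x \<otimes>\<^bsub>Z\<^esub> inv\<^bsub>Z\<^esub> \<one>\<^bsub>Z\<^esub> \<in> iter_commutator Z M (carrier Z) c"
      using h.hom_iter_commutator[OF N sub x] SYc[OF xS] by simp
    then have "s (h x) = s \<one>\<^bsub>Z\<^esub>"
      using SZ[OF xS] subgroup.one_closed[OF sSZ] by (intro s(2))
    also have "\<dots> = \<one>\<^bsub>Baer_quotient c Z M\<^esub>" using hom_one[OF s(1) gZ gB] by simp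
    finally show "x \<in> kernel (Y\<lparr>carrier := ?SY\<rparr>) (Baer_quotient c Z M) (s \<circ> h)"
      using xS by (simp add: kernel_def)
  qed
qed

text \<open>The diagram chase behind the theorem.  The component maps to \<open>F\<^sub>B\<close> and \<open>K\<close> are induced by \<open>\<beta>\<close> and \<open>\<alpha>\<close>.
  The group \<open>F\<close> serves to show that they are jointly onto: on \<open>\<gamma>\<^bsub>c+1\<^esub>(F)\<close>, the composites \<open>\<beta> \<sigma>\<close> and \<open>\<alpha> \<sigma>\<close>
  agree with \<open>\<rho>\<close> and \<open>\<pi>\<close> up to terms that vanish in the Baer quotients, and for \<open>(\<rho>, \<pi>)\<close> an element
  with prescribed values can be written down using the section \<open>j\<close> of \<open>\<rho>\<close>.\<close>

lemma Baer_quotient_joint_epi: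
  fixes F\<^sub>G :: "'g monoid" and F :: "'f monoid" and F\<^sub>B :: "'h monoid" and K :: "'k monoid"
  assumes G: "group_hom F\<^sub>G G \<nu>\<^sub>G" "group_hom K G \<kappa>" "group_hom F\<^sub>B B \<nu>\<^sub>B" "group_hom G B p"
    and lifts: "group_hom F\<^sub>G K \<alpha>" "\<And>x. x \<in> carrier F\<^sub>G \<Longrightarrow> \<kappa> (\<alpha> x) = \<nu>\<^sub>G x"
      "group_hom F\<^sub>G F\<^sub>B \<beta>" "\<And>x. x \<in> carrier F\<^sub>G \<Longrightarrow> \<nu>\<^sub>B (\<beta> x) = p (\<nu>\<^sub>G x)"
    and \<sigma>: "group_hom F F\<^sub>G \<sigma>" "\<And>x. x \<in> carrier F \<Longrightarrow> \<nu>\<^sub>G (\<sigma> x) = \<kappa> (\<pi> x)"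
    and \<pi>: "group_hom F K \<pi>" "\<pi> ` carrier F = carrier K"
    and \<rho>: "group_hom F F\<^sub>B \<rho>" "\<And>x. x \<in> carrier F \<Longrightarrow> \<nu>\<^sub>B (\<rho> x) = p (\<kappa> (\<pi> x))"
    and j: "group_hom F\<^sub>B F j" "\<And>r. r \<in> carrier F\<^sub>B \<Longrightarrow> \<rho> (j r) = r"
      "\<And>r. r \<in> kernel F\<^sub>B B \<nu>\<^sub>B \<Longrightarrow> \<pi> (j r) = \<one>\<^bsub>K\<^esub>"
  shows "\<exists>\<phi>. \<phi> \<in> epi (Baer_quotient c F\<^sub>G (kernel F\<^sub>G G \<nu>\<^sub>G))
    (Baer_quotient c F\<^sub>B (kernel F\<^sub>B B \<nu>\<^sub>B) \<times>\<times> Baer_quotient c K (kernel K G \<kappa>))"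
proof -
  interpret \<nu>\<^sub>G: group_hom F\<^sub>G G \<nu>\<^sub>G by fact
  interpret \<kappa>: group_hom K G \<kappa> by fact
  interpret \<nu>\<^sub>B: group_hom F\<^sub>B B \<nu>\<^sub>B by fact
  interpret p: group_hom G B p by fact
  interpret \<alpha>: group_hom F\<^sub>G K \<alpha> by fact
  interpret \<beta>: group_hom F\<^sub>G F\<^sub>B \<beta> by fact
  interpret \<sigma>: group_hom F F\<^sub>G \<sigma> by fact
  interpret \<pi>: group_hom F K \<pi> by fact
  interpret \<rho>: group_hom F F\<^sub>B \<rho> by fact
  interpret j: group_hom F\<^sub>B F j by fact
  let ?R = "kernel F\<^sub>G G \<nu>\<^sub>G" and ?S = "kernel F\<^sub>B B \<nu>\<^sub>B" and ?T = "kernel K G \<kappa>"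
  let ?SG = "?R \<inter> lower_central F\<^sub>G (c + 1)" and ?SB = "?S \<inter> lower_central F\<^sub>B (c + 1)"
    and ?SK = "?T \<inter> lower_central K (c + 1)"
  let ?M = "Baer_quotient c F\<^sub>B ?S \<times>\<times> Baer_quotient c K ?T"
  note nR = \<nu>\<^sub>G.normal_kernel and nS = \<nu>\<^sub>B.normal_kernel and nT = \<kappa>.normal_kernel
  obtain s where s: "s \<in> hom (F\<^sub>B\<lparr>carrier := ?SB\<rparr>) (Baer_quotient c F\<^sub>B ?S)"
    "s ` ?SB = carrier (Baer_quotient c F\<^sub>B ?S)"
    and s_eq: "\<And>x y. x \<in> ?SB \<Longrightarrow> y \<in> ?SB \<Longrightarrow>
      x \<otimes>\<^bsub>F\<^sub>B\<^esub> inv\<^bsub>F\<^sub>B\<^esub> y \<in> iter_commutator F\<^sub>B ?S (carrier F\<^sub>B) c \<Longrightarrow> s x = s y"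
    using Baer_quotient_projection[OF \<nu>\<^sub>B.G.is_group nS] by blast
  obtain t where t: "t \<in> hom (K\<lparr>carrier := ?SK\<rparr>) (Baer_quotient c K ?T)"
    "t ` ?SK = carrier (Baer_quotient c K ?T)"
    and t_eq: "\<And>x y. x \<in> ?SK \<Longrightarrow> y \<in> ?SK \<Longrightarrow>
      x \<otimes>\<^bsub>K\<^esub> inv\<^bsub>K\<^esub> y \<in> iter_commutator K ?T (carrier K) c \<Longrightarrow> t x = t y"
    using Baer_quotient_projection[OF \<kappa>.G.is_group nT] by blast
  have \<alpha>R: "\<alpha> ` ?R \<subseteq> ?T" using lifts(2) by (auto simp: kernel_def)
  have \<beta>R: "\<beta> ` ?R \<subseteq> ?S" using lifts(4) by (auto simp: kernel_def)
  note m\<alpha> = Baer_quotient_map[OF lifts(1) nR nT \<alpha>R t(1) t_eq]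
  note m\<beta> = Baer_quotient_map[OF lifts(3) nR nS \<beta>R s(1) s_eq]
  define \<psi> where "\<psi> x = (s (\<beta> x), t (\<alpha> x))" for x
  have \<psi>: "\<psi> \<in> hom (F\<^sub>G\<lparr>carrier := ?SG\<rparr>) ?M"
    using m\<alpha>(1) m\<beta>(1) by (simp add: hom_pairwise \<psi>_def comp_def)
  let ?L = "iter_commutator F\<^sub>G ?R (carrier F\<^sub>G) c"
  have L: "?L \<lhd> F\<^sub>G\<lparr>carrier := ?SG\<rparr>" by (rule iter_commutator_normal_Baer[OF \<nu>\<^sub>G.G.is_group nR])
  have gM: "group ?M"
    using comm_group_Baer_quotient[OF \<nu>\<^sub>B.G.is_group nS] comm_group_Baer_quotient[OF \<kappa>.G.is_group nT]
    by (intro DirProd_group) (simp_all add: comm_group_def)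
  interpret \<psi>: group_hom "F\<^sub>G\<lparr>carrier := ?SG\<rparr>" ?M \<psi>
    by (intro group_hom.intro group_hom_axioms.intro normal.axioms(2)[OF L] gM \<psi>)
  have "?L \<subseteq> kernel (F\<^sub>G\<lparr>carrier := ?SG\<rparr>) ?M \<psi>"
    using m\<alpha>(2) m\<beta>(2) by (auto simp: kernel_def \<psi>_def)
  then obtain \<phi> where \<phi>: "\<phi> \<in> hom (F\<^sub>G\<lparr>carrier := ?SG\<rparr> Mod ?L) ?M"
    "\<And>x. x \<in> ?SG \<Longrightarrow> \<phi> (?L #>\<^bsub>F\<^sub>G\<lparr>carrier := ?SG\<rparr>\<^esub> x) = \<psi> x"
    using \<psi>.FactGroup_universal_kernel[OF L] by auto
  have "v \<in> \<phi> ` carrier (F\<^sub>G\<lparr>carrier := ?SG\<rparr> Mod ?L)" if v: "v \<in> carrier ?M" for v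
  proof -
    obtain r k where rk: "v = (s r, t k)" "r \<in> ?SB" "k \<in> ?SK"
      using v unfolding carrier_DirProd s(2)[symmetric] t(2)[symmetric] by blast
    have rc: "r \<in> carrier F\<^sub>B" and kc: "k \<in> carrier K" using rk by (auto simp: kernel_def)
    have "\<pi> ` lower_central F (Suc c) = lower_central K (Suc c)"
      unfolding lower_central_eq using \<pi>.image_iter_commutator[OF \<sigma>.G.carrier_normal \<pi>(2)] \<pi>(2) by simp
    then obtain y where y: "y \<in> lower_central F (Suc c)" "\<pi> y = k"
      using rk(3) by (metis IntD2 Suc_eq_plus1 imageE)
    have yc: "y \<in> carrier F" using y(1) by (rule \<sigma>.G.lower_central_carrier)
    define z where "z = \<rho> y"
    define d where "d = inv\<^bsub>F\<^sub>B\<^esub> z \<otimes>\<^bsub>F\<^sub>B\<^esub> r"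
    \<comment> \<open>Multiplying by \<open>j d\<close> corrects the component in \<open>F\<^sub>B\<close> without changing that in \<open>K\<close>.\<close>
    define x where "x = y \<otimes>\<^bsub>F\<^esub> j d"
    have zc: "z \<in> carrier F\<^sub>B" using yc by (simp add: z_def)
    have dc: "d \<in> carrier F\<^sub>B" using zc rc by (simp add: d_def)
    have "\<nu>\<^sub>B z = \<one>\<^bsub>B\<^esub>" using \<rho>(2)[OF yc] y(2) rk(3) by (simp add: z_def kernel_def)
    then have dS: "d \<in> ?S" using zc rc rk(2) by (simp add: kernel_def d_def)
    have "z \<in> lower_central F\<^sub>B (Suc c)" unfolding z_def using y(1) by (rule \<rho>.hom_lower_central)
    then have "d \<in> lower_central F\<^sub>B (Suc c)"
      unfolding d_def using rk(2) normal_imp_subgroup[OF \<nu>\<^sub>B.G.lower_central_normal[of c]]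
      by (intro subgroup.m_closed subgroup.m_inv_closed) auto
    then have "j d \<in> lower_central F (Suc c)" by (rule j.hom_lower_central)
    then have x\<gamma>: "x \<in> lower_central F (Suc c)"
      unfolding x_def using y(1) normal_imp_subgroup[OF \<sigma>.G.lower_central_normal[of c]]
      by (intro subgroup.m_closed)
    have xc: "x \<in> carrier F" using x\<gamma> by (rule \<sigma>.G.lower_central_carrier)
    have \<pi>x: "\<pi> x = k" using yc dc dS j(3) kc y(2) by (simp add: x_def)
    have \<rho>x: "\<rho> x = r" using yc dc zc rc j(2) by (simp add: x_def d_def flip: z_def)
    have "\<nu>\<^sub>G (\<sigma> x) = \<one>\<^bsub>G\<^esub>" using \<sigma>(2)[OF xc] \<pi>x rk(3) by (simp add: kernel_def)
    then have \<sigma>S: "\<sigma> x \<in> ?SG" using \<sigma>.hom_lower_central[OF x\<gamma>] xc by (simp add: kernel_def)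
    have "\<alpha> (\<sigma> x) \<otimes>\<^bsub>K\<^esub> inv\<^bsub>K\<^esub> \<pi> x \<in> iter_commutator K ?T (carrier K) c"
    proof (rule hom_agree_lower_central[OF _ \<pi>(1) nT _ x\<gamma>, of "\<alpha> \<circ> \<sigma>", unfolded comp_def])
      show "group_hom F K (\<lambda>x. \<alpha> (\<sigma> x))" by unfold_locales (auto simp: hom_def)
      show "\<alpha> (\<sigma> x) \<otimes>\<^bsub>K\<^esub> inv\<^bsub>K\<^esub> \<pi> x \<in> ?T" if "x \<in> carrier F" for x
        using that lifts(2)[of "\<sigma> x"] \<sigma>(2)[of x] by (subst \<kappa>.kernel_diff_iff) auto
    qed
    then have 1: "t (\<alpha> (\<sigma> x)) = t k"
      using \<sigma>S \<alpha>R \<alpha>.hom_lower_central[of "\<sigma> x" c] rk(3) unfolding \<pi>x by (intro t_eq) auto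
    have "\<beta> (\<sigma> x) \<otimes>\<^bsub>F\<^sub>B\<^esub> inv\<^bsub>F\<^sub>B\<^esub> \<rho> x \<in> iter_commutator F\<^sub>B ?S (carrier F\<^sub>B) c"
    proof (rule hom_agree_lower_central[OF _ \<rho>(1) nS _ x\<gamma>, of "\<beta> \<circ> \<sigma>", unfolded comp_def])
      show "group_hom F F\<^sub>B (\<lambda>x. \<beta> (\<sigma> x))" by unfold_locales (auto simp: hom_def)
      show "\<beta> (\<sigma> x) \<otimes>\<^bsub>F\<^sub>B\<^esub> inv\<^bsub>F\<^sub>B\<^esub> \<rho> x \<in> ?S" if "x \<in> carrier F" for x
        using that lifts(4)[of "\<sigma> x"] \<sigma>(2)[of x] \<rho>(2)[of x] by (subst \<nu>\<^sub>B.kernel_diff_iff) auto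
    qed
    then have 2: "s (\<beta> (\<sigma> x)) = s r"
      using \<sigma>S \<beta>R \<beta>.hom_lower_central[of "\<sigma> x" c] rk(2) unfolding \<rho>x by (intro s_eq) auto
    have "v = \<phi> (?L #>\<^bsub>F\<^sub>G\<lparr>carrier := ?SG\<rparr>\<^esub> \<sigma> x)" using \<phi>(2)[OF \<sigma>S] 1 2 rk(1) by (simp add: \<psi>_def)
    then show ?thesis unfolding carrier_FactGroup using \<sigma>S by (intro image_eqI) auto
  qed
  then have "\<phi> ` carrier (F\<^sub>G\<lparr>carrier := ?SG\<rparr> Mod ?L) = carrier ?M"
    using hom_carrier[OF \<phi>(1)] by blast
  then have "\<phi> \<in> epi (F\<^sub>G\<lparr>carrier := ?SG\<rparr> Mod ?L) ?M"
    unfolding epi_def using \<phi>(1) by blast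
  then show ?thesis unfolding Baer_quotient_def by blast
qed

section \<open>The theorem\<close>

theorem theorem3p6:
  fixes c :: nat
    and G :: "'a monoid" and A B :: "'a set" and \<theta> :: "'a \<Rightarrow> 'a \<Rightarrow> 'a"
    and F\<^sub>1 :: "'f monoid" and \<nu>\<^sub>1 :: "'f \<Rightarrow> 'a"
    and F\<^sub>G :: "'g monoid" and \<nu>\<^sub>G :: "'g \<Rightarrow> 'a"
    and F\<^sub>B :: "'h monoid" and \<nu>\<^sub>B :: "'h \<Rightarrow> 'a"
  defines "K \<equiv> free_product F\<^sub>1 (G\<lparr>carrier := B\<rparr>)"
    and "T \<equiv> T_subgroup F\<^sub>1 \<nu>\<^sub>1 (G\<lparr>carrier := B\<rparr>) \<theta>"
  assumes "c \<ge> 1"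
    and "semidirect_product G A B \<theta>"
    and "free_presentation F\<^sub>1 \<nu>\<^sub>1 (G\<lparr>carrier := A\<rparr>)"
    and "free_presentation F\<^sub>G \<nu>\<^sub>G G"
    and "free_presentation F\<^sub>B \<nu>\<^sub>B (G\<lparr>carrier := B\<rparr>)"
  shows "(\<exists>\<phi>. \<phi> \<in> epi (nilpotent_multiplier c F\<^sub>G \<nu>\<^sub>G G)
             (nilpotent_multiplier c F\<^sub>B \<nu>\<^sub>B (G\<lparr>carrier := B\<rparr>) \<times>\<times> Baer_quotient c K T))
       \<and> (finite (carrier G) \<longrightarrow>
           (\<exists>H. subgroup H (nilpotent_multiplier c F\<^sub>G \<nu>\<^sub>G G) \<and>
             (nilpotent_multiplier c F\<^sub>G \<nu>\<^sub>G G)\<lparr>carrier := H\<rparr>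
               \<cong> nilpotent_multiplier c F\<^sub>B \<nu>\<^sub>B (G\<lparr>carrier := B\<rparr>) \<times>\<times> Baer_quotient c K T))"
proof -
  let ?A = "G\<lparr>carrier := A\<rparr>" and ?B = "G\<lparr>carrier := B\<rparr>"
  note sd = assms(4)[unfolded semidirect_product_def]
  interpret A: normal A G using sd by simp
  interpret B: subgroup B G using sd by simp
  have gB: "group ?B" using A.is_group B.subgroup_is_group by blast
  note gG = A.is_group
  have free: "is_free_group F\<^sub>1" "is_free_group F\<^sub>G" "is_free_group F\<^sub>B"
    and gF: "group F\<^sub>1" "group F\<^sub>G" "group F\<^sub>B"
    and epi: "\<nu>\<^sub>1 \<in> epi F\<^sub>1 ?A" "\<nu>\<^sub>G \<in> epi F\<^sub>G G" "\<nu>\<^sub>B \<in> epi F\<^sub>B ?B"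
    using assms(5-7) by (simp_all add: free_presentation_def is_free_group_def)
  have \<nu>\<^sub>1: "\<nu>\<^sub>1 \<in> hom F\<^sub>1 G" "\<And>f. f \<in> carrier F\<^sub>1 \<Longrightarrow> \<nu>\<^sub>1 f \<in> A"
    and \<nu>\<^sub>G: "\<nu>\<^sub>G \<in> hom F\<^sub>G G" and \<nu>\<^sub>B: "\<nu>\<^sub>B \<in> hom F\<^sub>B ?B" and \<nu>\<^sub>B': "\<nu>\<^sub>B \<in> hom F\<^sub>B G"
    and \<nu>\<^sub>B_in: "\<And>f. f \<in> carrier F\<^sub>B \<Longrightarrow> \<nu>\<^sub>B f \<in> B" and \<nu>\<^sub>B_onto: "\<nu>\<^sub>B ` carrier F\<^sub>B = B"
    using epi A.subset B.subset by (auto simp: epi_def hom_def Pi_iff)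
  have "A <#>\<^bsub>G\<^esub> B = carrier G" "A \<inter> B = {\<one>\<^bsub>G\<^esub>}" using sd by auto
  then obtain p where p: "p \<in> hom G ?B" "\<forall>a\<in>A. \<forall>b\<in>B. p (a \<otimes>\<^bsub>G\<^esub> b) = b"
    using A.complement_projection[OF conjunct1[OF conjunct2[OF sd]] B.subgroup_axioms] by blast
  have pA: "p a = \<one>\<^bsub>G\<^esub>" if "a \<in> A" for a
    using bspec[OF bspec[OF p(2) that] B.one_closed] that by simp
  have pB: "p b = b" if "b \<in> B" for b
    using bspec[OF bspec[OF p(2) subgroup.one_closed[OF A.subgroup_axioms]] that] that by simp
  obtain \<kappa> where \<kappa>: "\<kappa> \<in> epi K G" "\<And>f. f \<in> carrier F\<^sub>1 \<Longrightarrow> \<kappa> (fp_inl F\<^sub>1 ?B f) = \<nu>\<^sub>1 f"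
    "\<And>b. b \<in> B \<Longrightarrow> \<kappa> (fp_inr F\<^sub>1 ?B b) = b"
    using semidirect_free_product_epi[OF assms(4,5)] unfolding K_def by blast
  have \<kappa>': "\<kappa> \<in> hom K G" using \<kappa>(1) by (simp add: epi_def)
  have gK: "group K" unfolding K_def using gF(1) gB by (rule group_free_product)
  have T: "T = kernel K G \<kappa>"
    unfolding T_def K_def using assms(4,5) \<kappa>'[unfolded K_def] \<kappa>(2,3) by (rule T_subgroup_eq_kernel)
  obtain \<alpha> where \<alpha>: "\<alpha> \<in> hom F\<^sub>G K" "\<And>x. x \<in> carrier F\<^sub>G \<Longrightarrow> \<kappa> (\<alpha> x) = \<nu>\<^sub>G x"
    using free_group_lift[OF free(2) gK gG \<kappa>(1) \<nu>\<^sub>G] by blast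
  have "p \<circ> \<nu>\<^sub>G \<in> hom F\<^sub>G ?B" using \<nu>\<^sub>G p(1) by (rule Group.hom_compose)
  from free_group_lift[OF free(2) gF(3) gB epi(3) this, unfolded comp_def] obtain \<beta> where \<beta>: "\<beta> \<in> hom F\<^sub>G F\<^sub>B" "\<And>x. x \<in> carrier F\<^sub>G \<Longrightarrow> \<nu>\<^sub>B (\<beta> x) = p (\<nu>\<^sub>G x)"
    by blast
  obtain \<sigma>\<^sub>1 where \<sigma>\<^sub>1: "\<sigma>\<^sub>1 \<in> hom F\<^sub>1 F\<^sub>G" "\<And>x. x \<in> carrier F\<^sub>1 \<Longrightarrow> \<nu>\<^sub>G (\<sigma>\<^sub>1 x) = \<nu>\<^sub>1 x"
    using free_group_lift[OF free(1) gF(2) gG epi(2) \<nu>\<^sub>1(1)] by blast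
  obtain \<sigma>\<^sub>2 where \<sigma>\<^sub>2: "\<sigma>\<^sub>2 \<in> hom F\<^sub>B F\<^sub>G" "\<And>x. x \<in> carrier F\<^sub>B \<Longrightarrow> \<nu>\<^sub>G (\<sigma>\<^sub>2 x) = \<nu>\<^sub>B x"
    using free_group_lift[OF free(3) gF(2) gG epi(2) \<nu>\<^sub>B'] by blast
  \<comment> \<open>The group \<open>F\<^sub>1 * F\<^sub>B\<close>, with \<open>\<sigma>\<close> to \<open>F\<^sub>G\<close>, \<open>\<pi>\<close> onto \<open>K\<close>, and the retraction \<open>\<rho>\<close> onto \<open>F\<^sub>B\<close>.\<close>
  define F where "F = free_product F\<^sub>1 F\<^sub>B"
  define i where "i = fp_inl F\<^sub>1 F\<^sub>B"
  define j where "j = fp_inr F\<^sub>1 F\<^sub>B"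
  note Fdefs = F_def i_def j_def
  have gFF: "group F" unfolding F_def using gF(1,3) by (rule group_free_product)
  have ij: "i \<in> hom F\<^sub>1 F" "j \<in> hom F\<^sub>B F" unfolding Fdefs using free_product_inj_hom gF by blast+
  note F_exists = free_product_hom_exists[OF gF(1,3), folded Fdefs]
  note F_eqI = free_product_hom_eqI[OF gF(1,3), folded Fdefs]
  obtain \<sigma> where \<sigma>: "\<sigma> \<in> hom F F\<^sub>G" "\<And>x. x \<in> carrier F\<^sub>1 \<Longrightarrow> \<sigma> (i x) = \<sigma>\<^sub>1 x"
    "\<And>x. x \<in> carrier F\<^sub>B \<Longrightarrow> \<sigma> (j x) = \<sigma>\<^sub>2 x"
    using F_exists[OF gF(2) \<sigma>\<^sub>1(1) \<sigma>\<^sub>2(1)] by blast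
  note inK = free_product_inj_hom[OF gF(1) gB, folded K_def]
  have "(\<lambda>x. fp_inr F\<^sub>1 ?B (\<nu>\<^sub>B x)) \<in> hom F\<^sub>B K"
    using Group.hom_compose[OF \<nu>\<^sub>B inK(2)] by (simp add: comp_def)
  from F_exists[OF gK inK(1) this]
  obtain \<pi> where \<pi>: "\<pi> \<in> hom F K" "\<And>x. x \<in> carrier F\<^sub>1 \<Longrightarrow> \<pi> (i x) = fp_inl F\<^sub>1 ?B x"
    "\<And>x. x \<in> carrier F\<^sub>B \<Longrightarrow> \<pi> (j x) = fp_inr F\<^sub>1 ?B (\<nu>\<^sub>B x)"
    by blast
  have "(\<lambda>_. \<one>\<^bsub>F\<^sub>B\<^esub>) \<in> hom F\<^sub>1 F\<^sub>B" "(\<lambda>x. x) \<in> hom F\<^sub>B F\<^sub>B"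
    using gF(3) group.is_monoid by (auto simp: hom_def monoid.one_closed monoid.r_one)
  from F_exists[OF gF(3) this]
  obtain \<rho> where \<rho>: "\<rho> \<in> hom F F\<^sub>B" "\<And>x. x \<in> carrier F\<^sub>1 \<Longrightarrow> \<rho> (i x) = \<one>\<^bsub>F\<^sub>B\<^esub>"
    "\<And>x. x \<in> carrier F\<^sub>B \<Longrightarrow> \<rho> (j x) = x"
    by blast
  have \<sigma>\<pi>: "\<nu>\<^sub>G (\<sigma> x) = \<kappa> (\<pi> x)" if "x \<in> carrier F" for x
  proof -
    have "(\<nu>\<^sub>G \<circ> \<sigma>) x = (\<kappa> \<circ> \<pi>) x"
      by (rule F_eqI[OF gG Group.hom_compose[OF \<sigma>(1) \<nu>\<^sub>G] Group.hom_compose[OF \<pi>(1) \<kappa>']];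
        simp add: that \<sigma> \<sigma>\<^sub>1 \<sigma>\<^sub>2 \<pi> \<kappa> \<nu>\<^sub>B_in)
    then show ?thesis by simp
  qed
  have \<rho>\<pi>: "\<nu>\<^sub>B (\<rho> x) = p (\<kappa> (\<pi> x))" if "x \<in> carrier F" for x
  proof -
    have "\<nu>\<^sub>B \<one>\<^bsub>F\<^sub>B\<^esub> = \<one>\<^bsub>G\<^esub>" using hom_one[OF \<nu>\<^sub>B gF(3) gB] by simp
    note one = this
    have "(\<nu>\<^sub>B \<circ> \<rho>) x = (p \<circ> (\<kappa> \<circ> \<pi>)) x"
      by (rule F_eqI[OF gB Group.hom_compose[OF \<rho>(1) \<nu>\<^sub>B]
            Group.hom_compose[OF Group.hom_compose[OF \<pi>(1) \<kappa>'] p(1)]];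
        simp add: that one \<rho> \<pi> \<kappa> \<nu>\<^sub>B_in pA pB \<nu>\<^sub>1(2))
    then show ?thesis by simp
  qed
  note gh = group_hom.intro[OF _ _ group_hom_axioms.intro]
  interpret \<pi>: group_hom F K \<pi> using gFF gK \<pi>(1) by (rule gh)
  have \<pi>_onto: "\<pi> ` carrier F = carrier K"
  proof
    have "x \<in> \<pi> ` carrier F" if "x \<in> carrier K" for x
      using that unfolding K_def
    proof (induction rule: free_product_induct)
      case one
      then show ?case using \<pi>.hom_one \<pi>.G.one_closed unfolding K_def by (metis image_eqI)
    next
      case (inl a y)
      then obtain z where "z \<in> carrier F" "y = \<pi> z" by blast
      then have "\<pi> (i a \<otimes>\<^bsub>F\<^esub> z) = fp_inl F\<^sub>1 ?B a \<otimes>\<^bsub>K\<^esub> y" "i a \<otimes>\<^bsub>F\<^esub> z \<in> carrier F"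
        using inl(1) \<pi>(2) hom_in_carrier[OF ij(1)] by auto
      then show ?case unfolding K_def by (metis image_eqI)
    next
      case (inr b y)
      then obtain z where "z \<in> carrier F" "y = \<pi> z" by blast
      moreover obtain r where "r \<in> carrier F\<^sub>B" "b = \<nu>\<^sub>B r" using inr(1) \<nu>\<^sub>B_onto by auto
      ultimately have "\<pi> (j r \<otimes>\<^bsub>F\<^esub> z) = fp_inr F\<^sub>1 ?B b \<otimes>\<^bsub>K\<^esub> y" "j r \<otimes>\<^bsub>F\<^esub> z \<in> carrier F"
        using \<pi>(3) hom_in_carrier[OF ij(2)] by auto
      then show ?case unfolding K_def by (metis image_eqI)
    qed
    then show "carrier K \<subseteq> \<pi> ` carrier F" by blast
  qed auto
  have \<pi>j: "\<pi> (j r) = \<one>\<^bsub>K\<^esub>" if "r \<in> kernel F\<^sub>B ?B \<nu>\<^sub>B" for r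
    using that \<pi>(3)[of r] hom_one[OF inK(2) gB gK] by (simp add: kernel_def)
  have epi_M: "\<exists>\<phi>. \<phi> \<in> epi (nilpotent_multiplier c F\<^sub>G \<nu>\<^sub>G G)
             (nilpotent_multiplier c F\<^sub>B \<nu>\<^sub>B ?B \<times>\<times> Baer_quotient c K T)"
    unfolding nilpotent_multiplier_def T
    using gh[OF gF(2) gG \<nu>\<^sub>G] gh[OF gK gG \<kappa>'] gh[OF gF(3) gB \<nu>\<^sub>B] gh[OF gG gB p(1)]
      gh[OF gF(2) gK \<alpha>(1)] \<alpha>(2) gh[OF gF(2,3) \<beta>(1)] \<beta>(2) gh[OF gFF gF(2) \<sigma>(1)] \<sigma>\<pi>
      \<pi>.group_hom_axioms \<pi>_onto gh[OF gFF gF(3) \<rho>(1)] \<rho>\<pi> gh[OF gF(3) gFF ij(2)] \<rho>(3) \<pi>j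
    by (rule Baer_quotient_joint_epi)
  moreover have "\<exists>H. subgroup H (nilpotent_multiplier c F\<^sub>G \<nu>\<^sub>G G) \<and>
             (nilpotent_multiplier c F\<^sub>G \<nu>\<^sub>G G)\<lparr>carrier := H\<rparr>
               \<cong> nilpotent_multiplier c F\<^sub>B \<nu>\<^sub>B ?B \<times>\<times> Baer_quotient c K T"
    if "finite (carrier G)"
  proof -
    note nR = group_hom.normal_kernel[OF gh[OF gF(2) gG \<nu>\<^sub>G]]
      and nS = group_hom.normal_kernel[OF gh[OF gF(3) gB \<nu>\<^sub>B]]
      and nT = group_hom.normal_kernel[OF gh[OF gK gG \<kappa>']]
    have "comm_group (nilpotent_multiplier c F\<^sub>G \<nu>\<^sub>G G)"
      unfolding nilpotent_multiplier_def by (rule comm_group_Baer_quotient[OF gF(2) nR])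
    moreover have "group (nilpotent_multiplier c F\<^sub>B \<nu>\<^sub>B ?B \<times>\<times> Baer_quotient c K T)"
      unfolding nilpotent_multiplier_def T
      by (rule DirProd_group[OF comm_group.axioms(2)[OF comm_group_Baer_quotient[OF gF(3) nS]]
            comm_group.axioms(2)[OF comm_group_Baer_quotient[OF gK nT]]])
    moreover have "finite (carrier (nilpotent_multiplier c F\<^sub>G \<nu>\<^sub>G G))"
      unfolding nilpotent_multiplier_def
      using gh[OF gF(2) gG \<nu>\<^sub>G] that by (rule finite_Baer_quotient)
    ultimately show ?thesis using epi_M comm_group.epimorphic_image_embeds by metis
  qed
  ultimately show ?thesis by blast
qed

end
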